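(* Consider the plant model of the context with arbitrary supply and demand state processes $X(t)$ and $Y(t)$. Suppose the Joint Purchasing and Pricing Algorithm (JPP) is implemented with $$\theta_m=\max_{\{k\in\{1,\ldots,K\}\,|\,\beta_{mk}>0\}}\left[\frac{V(P_{k,max}-\alpha_k)}{\beta_{mk}}+\sum_{i\in\{1,\ldots,M\},\,i\ne m}\frac{\beta_{ik}A_{i,max}}{\beta_{mk}}+2\mu_{m,max}\right]$$ and that $\mu_{m,max}\le Q_m(0)\le\theta_m+A_{m,max}$ for all $m\in\{1,\ldots,M\}$. Then for any arbitrary $X(t)$ and $Y(t)$ processes, for all $m$ and all slots $t\ge0$, $$\mu_{m,max}\le Q_m(t)\le Q_{m,max}:=\theta_m+A_{m,max},\qquad\text{where }Q_{m,max}=O(V).$$ Moreover, for any positive integers $J$ and $T$, and any $\hat H_{JT}(0)$ (which specifies the initial queue vector $\boldsymbol Q(0)$ satisfying $\mu_{m,max}\le Q_m(0)\le\theta_m+A_{m,max}$ for all $m\in\{1,\ldots,M\}$, and all values $X(\tau),Y(\tau)$ for $\tau\in\{0,1,\ldots,JT-1\}$), the time average profit over $\{0,1,\ldots,JT-1\}$ satisfies $$\frac1{JT}\sum_{\tau=0}^{JT-1}\mathbb{E}\{\phi(\tau)\mid\hat H_{JT}(0)\}\ge\frac1{JT}\sum_{j=0}^{J-1}\phi_T(jT)-\frac{BT}V-\frac{L(\boldsymbol Q(0))}{VJT},$$ where $\phi_T(jT)$ is the optimal $T$-slot lookahead value (defined in the context) over the interval $\{jT,\ldots,(j+1)T-1\}$,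 $B=\frac12\sum_{m=1}^M\max[A_{m,max}^2,\mu_{m,max}^2]$ and $L(\boldsymbol Q(t))=\frac12\sum_{m=1}^M(Q_m(t)-\theta_m)^2$.
   Context: **Plant model.** There are $M$ raw materials, $K$ products, and slots $t\in\{0,1,2,\ldots\}$. The nonnegative integer $\beta_{mk}$ is the number of units of material $m$ needed for one unit of product $k$ (each material is used by at least one product); $\alpha_k\ge0$ is the cost of assembling one unit of product $k$. *Supply and purchasing.* The supply state $X(t)=[(x_1(t),\ldots,x_M(t));(s_1(t),\ldots,s_M(t))]$ takes values in a finite or countably infinite set $\mathcal X$; $x_m(t)\ge0$ is the per-unit price of material $m$ and $s_m(t)\ge0$ the amount available. The purchase vector $\boldsymbol A(t)$ costs $c(\boldsymbol A(t),X(t))=\sum_{m=1}^Mx_m(t)A_m(t)$ and must lie in $\mathcal A(X(t))$, the set of integer vectors with $0\le A_m(t)\le\min[A_{m,max},s_m(t)]$ for all $m$ and $c(\boldsymbol A(t),X(t))\le c_{max}$ ($A_{m,max},c_{max}$ finite constants). *Demand and pricing.* The demand state $Y(t)$ takes values in a finite or countably infinite set $\mathcal Y$. Each slot the plant observes $\boldsymbol Q(t),X(t),Y(t)$, then chooses $\boldsymbol A(t)$, $Z_k(t)\in\{0,1\}$ ($1$ means product $k$ is offered) and prices $P_k(t)\in\mathcal P_k$, a compact set of nonnegative prices with maximum $P_{k,max}$. Consumers then generate integer demands $0\le D_k(t)\le D_{k,max}$ (finite integers); $D_k(t)$ depends on $P_k(t),Y(t)$ and is conditionally i.i.d. over all slots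 with the same $P_k(t),Y(t)$ values (its conditional law given the past, the whole exogenous processes $X,Y$, and the current decisions depends only on $P_k(t),Y(t)$), with mean $F_k(p,y)=\mathbb{E}\{D_k(t)\mid P_k(t)=p,Y(t)=y\}$ continuous in $p\in\mathcal P_k$ for each $y$. *Queues and profit.* $Q_m(t)$ is the integer inventory of material $m$. Define $\mu_{m,max}=\sum_{k=1}^K\beta_{mk}D_{k,max}$ and the instantaneous profit $\phi(t)=-c(\boldsymbol A(t),X(t))+\sum_{k=1}^KZ_k(t)D_k(t)(P_k(t)-\alpha_k)$. **JPP algorithm** (parameters $V>0$ and $\theta_m$). Let $1_k(t)=1$ if $Q_m(t)<\mu_{m,max}$ for some $m$ with $\beta_{mk}>0$, and $1_k(t)=0$ otherwise. Every slot $t$: (1) *Purchasing:* choose $\boldsymbol A(t)$ minimizing $Vc(\boldsymbol A(t),X(t))+\sum_{m=1}^MA_m(t)(Q_m(t)-\theta_m)$ subject to $\boldsymbol A(t)\in\mathcal A(X(t))$. (2) *Pricing:* for each $k$, if $1_k(t)=1$ set $Z_k(t)=0$. If $1_k(t)=0$, choose $P_k(t)\in\mathcal P_k$ maximizing $V(P_k(t)-\alpha_k)F_k(P_k(t),Y(t))+F_k(P_k(t),Y(t))\sum_{m=1}^M\beta_{mk}(Q_m(t)-\theta_m)$; if the maximum is positive set $Z_k(t)=1$, else set $Z_k(t)=0$. (3) *Queue update:* fulfil all demands for offered products: $Q_m(t+1)=Q_m(t)-\sum_{k=1}^K\beta_{mk}Z_k(t)D_k(t)+A_m(t)$. Minimizers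 and maximizers are selected by a fixed rule depending only on the current $\boldsymbol Q(t),X(t),Y(t)$. **Histories.** $H(t)=\{X(\tau),Y(\tau)\}_{\tau=0}^{t-1}\cup\{[Q_m(\tau)]_{m=1}^M\}_{\tau=0}^t$ and $\hat H_T(t)=H(t)\cup\{X(t),Y(t),\ldots,X(t+T-1),Y(t+T-1)\}\cup\{\boldsymbol Q(t)\}$. **$T$-slot lookahead value.** For a positive integer $T$ and $t_0\ge0$, $\phi_T(t_0)$ is the optimal (supremum) value of $$\sum_{\tau=t_0}^{t_0+T-1}\mathbb{E}\{\phi(\tau)\mid\hat H_T(t_0)\}$$ over all policies on the interval $\{t_0,\ldots,t_0+T-1\}$ that know all values $X(\tau),Y(\tau)$ of the interval in advance (but not the random demands $D_k(\tau)$), choose $P_k(\tau)\in\mathcal P_k$, $Z_k(\tau)\in\{0,1\}$, $\boldsymbol A(\tau)\in\mathcal A(X(\tau))$, and satisfy, for all $m$, $$\sum_{\tau=t_0}^{t_0+T-1}\mathbb{E}\Big\{A_m(\tau)-\sum_{k=1}^K\beta_{mk}Z_k(\tau)F_k(P_k(\tau),Y(\tau))\,\Big|\,\hat H_T(t_0)\Big\}=0.$$ No queue (inventory availability) constraint is imposed within the interval. $O(V)$ is with all parameters other than $V$ held fixed. *)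

theory Defs
  imports "HOL-Probability.Probability" "HOL-Library.Landau_Symbols"
begin

text \<open>Materials and products are indexed by finite types. A supply state is the pair
  (unit prices, available amounts). Demands and the coefficients \<open>\<beta>\<close> are naturals,
  purchases and inventories are integers; the inventories are not constrained to be nonnegative.\<close>

type_synonym 'm supply_state = "('m \<Rightarrow> real) \<times> ('m \<Rightarrow> real)"

record ('m, 'k, 'y) plant =
  beta :: "'m \<Rightarrow> 'k \<Rightarrow> nat"
  alpha :: "'k \<Rightarrow> real"
  supply_states :: "'m supply_state set"
  demand_states :: "'y set"
  Amax :: "'m \<Rightarrow> real"
  cmax :: real
  prices :: "'k \<Rightarrow> real set"
  Dmax :: "'k \<Rightarrow> nat"
  demand_dist :: "'k \<Rightarrow> real \<Rightarrow> 'y \<Rightarrow> nat pmf"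
    \<comment> \<open>law of the demand for product \<open>k\<close> at price \<open>p\<close> in demand state \<open>y\<close>\<close>

definition mean_demand :: "('m, 'k, 'y) plant \<Rightarrow> 'k \<Rightarrow> real \<Rightarrow> 'y \<Rightarrow> real" where
  "mean_demand S k p y = measure_pmf.expectation (demand_dist S k p y) real"

definition valid_plant :: "('m::finite, 'k::finite, 'y) plant \<Rightarrow> bool" where
  "valid_plant S \<longleftrightarrow>
     (\<forall>m. \<exists>k. beta S m k > 0) \<and>
     (\<forall>k. alpha S k \<ge> 0) \<and>
     countable (supply_states S) \<and>
     (\<forall>x\<in>supply_states S. \<forall>m. fst x m \<ge> 0 \<and> snd x m \<ge> 0) \<and>
     countable (demand_states S) \<and>
     (\<forall>k. compact (prices S k) \<and> prices S k \<noteq> {} \<and> (\<forall>p\<in>prices S k. p \<ge> 0)) \<and>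
     (\<forall>k. \<forall>p\<in>prices S k. \<forall>y\<in>demand_states S. set_pmf (demand_dist S k p y) \<subseteq> {..Dmax S k}) \<and>
     (\<forall>k. \<forall>y\<in>demand_states S. continuous_on (prices S k) (\<lambda>p. mean_demand S k p y))"

definition Pmax :: "('m, 'k, 'y) plant \<Rightarrow> 'k \<Rightarrow> real" where
  "Pmax S k = Sup (prices S k)"

definition purchase_cost :: "('m::finite \<Rightarrow> int) \<Rightarrow> 'm supply_state \<Rightarrow> real" where
  "purchase_cost a x = (\<Sum>m\<in>UNIV. fst x m * real_of_int (a m))"

definition purchases :: "('m::finite, 'k, 'y) plant \<Rightarrow> 'm supply_state \<Rightarrow> ('m \<Rightarrow> int) set" where
  "purchases S x =
     {a. (\<forall>m. 0 \<le> a m \<and> real_of_int (a m) \<le> min (Amax S m) (snd x m)) \<and>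
         purchase_cost a x \<le> cmax S}"

definition mu_max :: "('m, 'k::finite, 'y) plant \<Rightarrow> 'm \<Rightarrow> nat" where
  "mu_max S m = (\<Sum>k\<in>UNIV. beta S m k * Dmax S k)"

definition profit ::
  "('m::finite, 'k::finite, 'y) plant \<Rightarrow> 'm supply_state \<Rightarrow> ('m \<Rightarrow> int) \<Rightarrow> ('k \<Rightarrow> bool) \<Rightarrow>
   ('k \<Rightarrow> real) \<Rightarrow> ('k \<Rightarrow> nat) \<Rightarrow> real" where
  "profit S x a z p d =
     - purchase_cost a x + (\<Sum>k\<in>UNIV. of_bool (z k) * real (d k) * (p k - alpha S k))"

definition generated :: "'w measure \<Rightarrow> ('w \<Rightarrow> 'v) \<Rightarrow> 'v measure \<Rightarrow> 'w set set" where
  "generated M f N = sets (vimage_algebra (space M) f N)"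

text \<open>What is known when the demands of slot \<open>t\<close> are realised: the whole processes
  \<open>X\<close> and \<open>Y\<close>, all decisions up to and including slot \<open>t\<close>, all earlier
  demands, and the further events \<open>E t\<close> (used for the queue history).\<close>

definition information ::
  "'w measure \<Rightarrow> nat set \<Rightarrow> (nat \<Rightarrow> 'w set set) \<Rightarrow> (nat \<Rightarrow> 'w \<Rightarrow> 'x) \<Rightarrow> (nat \<Rightarrow> 'w \<Rightarrow> 'y) \<Rightarrow>
   (nat \<Rightarrow> 'w \<Rightarrow> 'm \<Rightarrow> int) \<Rightarrow> (nat \<Rightarrow> 'w \<Rightarrow> 'k \<Rightarrow> bool) \<Rightarrow> (nat \<Rightarrow> 'w \<Rightarrow> 'k \<Rightarrow> real) \<Rightarrow>
   (nat \<Rightarrow> 'w \<Rightarrow> 'k \<Rightarrow> nat) \<Rightarrow> nat \<Rightarrow> 'w measure" where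
  "information M I E X Y A Z P D t = sigma (space M)
     (E t \<union>
      (\<Union>s\<in>I. generated M (X s) (count_space UNIV) \<union> generated M (Y s) (count_space UNIV)) \<union>
      (\<Union>s\<in>I \<inter> {..t}. generated M (A s) (count_space UNIV) \<union>
         generated M (Z s) (count_space UNIV) \<union> (\<Union>k. generated M (\<lambda>w. P s w k) borel)) \<union>
      (\<Union>s\<in>I \<inter> {..<t}. generated M (D s) (count_space UNIV)))"

text \<open>Feasible (possibly randomised and history-dependent) operation on the slots \<open>I\<close>.
  No joint law of the demands for different products in the same slot is prescribed.\<close>

locale operation = prob_space M
  for M :: "'w measure" +
  fixes S :: "('m::finite, 'k::finite, 'y) plant"
    and I :: "nat set"
    and E :: "nat \<Rightarrow> 'w set set"
    and X :: "nat \<Rightarrow> 'w \<Rightarrow> 'm supply_state"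
    and Y :: "nat \<Rightarrow> 'w \<Rightarrow> 'y"
    and A :: "nat \<Rightarrow> 'w \<Rightarrow> 'm \<Rightarrow> int"
    and Z :: "nat \<Rightarrow> 'w \<Rightarrow> 'k \<Rightarrow> bool"
    and P :: "nat \<Rightarrow> 'w \<Rightarrow> 'k \<Rightarrow> real"
    and D :: "nat \<Rightarrow> 'w \<Rightarrow> 'k \<Rightarrow> nat"
  assumes X_measurable: "t \<in> I \<Longrightarrow> X t \<in> M \<rightarrow>\<^sub>M count_space (supply_states S)"
    and Y_measurable: "t \<in> I \<Longrightarrow> Y t \<in> M \<rightarrow>\<^sub>M count_space (demand_states S)"
    and A_measurable: "t \<in> I \<Longrightarrow> A t \<in> M \<rightarrow>\<^sub>M count_space UNIV"
    and Z_measurable: "t \<in> I \<Longrightarrow> Z t \<in> M \<rightarrow>\<^sub>M count_space UNIV"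
    and P_measurable: "t \<in> I \<Longrightarrow> (\<lambda>w. P t w k) \<in> borel_measurable M"
    and D_measurable: "t \<in> I \<Longrightarrow> D t \<in> M \<rightarrow>\<^sub>M count_space UNIV"
    and E_events: "t \<in> I \<Longrightarrow> E t \<subseteq> sets M"
    and A_feasible: "t \<in> I \<Longrightarrow> w \<in> space M \<Longrightarrow> A t w \<in> purchases S (X t w)"
    and P_feasible: "t \<in> I \<Longrightarrow> w \<in> space M \<Longrightarrow> P t w k \<in> prices S k"
    and D_bounded: "t \<in> I \<Longrightarrow> w \<in> space M \<Longrightarrow> D t w k \<le> Dmax S k"
    and D_law: "t \<in> I \<Longrightarrow>
      AE w in M. real_cond_exp M (information M I E X Y A Z P D t)
                   (indicator {v \<in> space M. D t v k = d}) w
                 = pmf (demand_dist S k (P t w k) (Y t w)) d"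

text \<open>Conditionally on the history \<open>\<hat>H\<^sub>T(t\<^sub>0)\<close>, the states on the interval are fixed
  sequences \<open>x\<close>, \<open>y\<close>, and a policy amounts to a joint law \<open>N\<close> of the decisions
  and demands \<open>(A, Z, P, D)\<close> on the interval. The rest of the history can only act as extra
  randomisation, since the conditional law of the demands does not depend on it.\<close>

type_synonym ('m, 'k) path = "nat \<Rightarrow> ('m \<Rightarrow> int) \<times> ('k \<Rightarrow> bool) \<times> ('k \<Rightarrow> real) \<times> ('k \<Rightarrow> nat)"

definition path_A :: "nat \<Rightarrow> ('m, 'k) path \<Rightarrow> 'm \<Rightarrow> int" where
  "path_A t h = fst (h t)"
definition path_Z :: "nat \<Rightarrow> ('m, 'k) path \<Rightarrow> 'k \<Rightarrow> bool" where
  "path_Z t h = fst (snd (h t))"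
definition path_P :: "nat \<Rightarrow> ('m, 'k) path \<Rightarrow> 'k \<Rightarrow> real" where
  "path_P t h = fst (snd (snd (h t)))"
definition path_D :: "nat \<Rightarrow> ('m, 'k) path \<Rightarrow> 'k \<Rightarrow> nat" where
  "path_D t h = snd (snd (snd (h t)))"

definition lookahead_policies ::
  "('m::finite, 'k::finite, 'y) plant \<Rightarrow> nat \<Rightarrow> nat \<Rightarrow> (nat \<Rightarrow> 'm supply_state) \<Rightarrow> (nat \<Rightarrow> 'y) \<Rightarrow>
   ('m, 'k) path measure set" where
  "lookahead_policies S T t0 x y =
     {N. operation N S {t0..<t0 + T} (\<lambda>_. {}) (\<lambda>t _. x t) (\<lambda>t _. y t)
           path_A path_Z path_P path_D \<and>
         (\<forall>m. (\<Sum>t\<in>{t0..<t0 + T}. LINT h|N. real_of_int (path_A t h m) -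
            (\<Sum>k\<in>UNIV. real (beta S m k) * of_bool (path_Z t h k)
                         * mean_demand S k (path_P t h k) (y t))) = 0)}"

definition lookahead_value ::
  "('m::finite, 'k::finite, 'y) plant \<Rightarrow> nat \<Rightarrow> nat \<Rightarrow> (nat \<Rightarrow> 'm supply_state) \<Rightarrow> (nat \<Rightarrow> 'y) \<Rightarrow>
   real" where
  "lookahead_value S T t0 x y =
     (SUP N\<in>lookahead_policies S T t0 x y. \<Sum>t\<in>{t0..<t0 + T}.
        LINT h|N. profit S (x t) (path_A t h) (path_Z t h) (path_P t h) (path_D t h))"

definition blocked :: "('m, 'k::finite, 'y) plant \<Rightarrow> ('m \<Rightarrow> int) \<Rightarrow> 'k \<Rightarrow> bool" where
  "blocked S q k \<longleftrightarrow> (\<exists>m. beta S m k > 0 \<and> q m < int (mu_max S m))"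

definition purchase_objective ::
  "real \<Rightarrow> ('m::finite \<Rightarrow> real) \<Rightarrow> ('m \<Rightarrow> int) \<Rightarrow> 'm supply_state \<Rightarrow> ('m \<Rightarrow> int) \<Rightarrow> real" where
  "purchase_objective V \<theta> q x a =
     V * purchase_cost a x + (\<Sum>m\<in>UNIV. real_of_int (a m) * (real_of_int (q m) - \<theta> m))"

definition price_objective ::
  "('m::finite, 'k, 'y) plant \<Rightarrow> real \<Rightarrow> ('m \<Rightarrow> real) \<Rightarrow> ('m \<Rightarrow> int) \<Rightarrow> 'y \<Rightarrow> 'k \<Rightarrow> real \<Rightarrow> real" where
  "price_objective S V \<theta> q y k p =
     V * (p - alpha S k) * mean_demand S k p y +
     mean_demand S k p y * (\<Sum>m\<in>UNIV. real (beta S m k) * (real_of_int (q m) - \<theta> m))"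

definition queue_events :: "'w measure \<Rightarrow> (nat \<Rightarrow> 'w \<Rightarrow> 'm \<Rightarrow> int) \<Rightarrow> nat \<Rightarrow> 'w set set" where
  "queue_events M Q t = (\<Union>s\<in>{..t}. generated M (Q s) (count_space UNIV))"

text \<open>The price of a blocked product is an arbitrary element of its price set.\<close>

locale jpp = operation M S UNIV "queue_events M Q" X Y A Z P D
  for M :: "'w measure"
    and S :: "('m::finite, 'k::finite, 'y) plant"
    and X :: "nat \<Rightarrow> 'w \<Rightarrow> 'm supply_state"
    and Y :: "nat \<Rightarrow> 'w \<Rightarrow> 'y"
    and Q :: "nat \<Rightarrow> 'w \<Rightarrow> 'm \<Rightarrow> int"
    and A :: "nat \<Rightarrow> 'w \<Rightarrow> 'm \<Rightarrow> int"
    and Z :: "nat \<Rightarrow> 'w \<Rightarrow> 'k \<Rightarrow> bool"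
    and P :: "nat \<Rightarrow> 'w \<Rightarrow> 'k \<Rightarrow> real"
    and D :: "nat \<Rightarrow> 'w \<Rightarrow> 'k \<Rightarrow> nat" +
  fixes V :: real
    and \<theta> :: "'m \<Rightarrow> real"
  assumes plant: "valid_plant S"
    and purchasing: "w \<in> space M \<Longrightarrow>
      is_arg_min (purchase_objective V \<theta> (Q t w) (X t w)) (\<lambda>a. a \<in> purchases S (X t w)) (A t w)"
    and not_offered: "w \<in> space M \<Longrightarrow> blocked S (Q t w) k \<Longrightarrow> \<not> Z t w k"
    and pricing: "w \<in> space M \<Longrightarrow> \<not> blocked S (Q t w) k \<Longrightarrow>
      is_arg_max (price_objective S V \<theta> (Q t w) (Y t w) k) (\<lambda>p. p \<in> prices S k) (P t w k)"
    and offering: "w \<in> space M \<Longrightarrow> \<not> blocked S (Q t w) k \<Longrightarrow>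
      Z t w k \<longleftrightarrow> price_objective S V \<theta> (Q t w) (Y t w) k (P t w k) > 0"
    and purchasing_rule:
      "\<exists>f. \<forall>t. \<forall>w\<in>space M. A t w = f (Q t w) (X t w) (Y t w)"
    and pricing_rule:
      "\<exists>g. \<forall>t. \<forall>w\<in>space M. \<forall>k. \<not> blocked S (Q t w) k \<longrightarrow> P t w k = g k (Q t w) (X t w) (Y t w)"
    and queue_update: "w \<in> space M \<Longrightarrow>
      Q (Suc t) w m = Q t w m - (\<Sum>k\<in>UNIV. int (beta S m k) * of_bool (Z t w k) * int (D t w k))
                      + A t w m"

definition theta :: "('m::finite, 'k::finite, 'y) plant \<Rightarrow> real \<Rightarrow> 'm \<Rightarrow> real" where
  "theta S V m = Max ((\<lambda>k.
       V * (Pmax S k - alpha S k) / real (beta S m k)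
       + (\<Sum>i\<in>UNIV - {m}. real (beta S i k) * Amax S i / real (beta S m k))
       + 2 * real (mu_max S m)) ` {k. beta S m k > 0})"

definition Qmax :: "('m::finite, 'k::finite, 'y) plant \<Rightarrow> real \<Rightarrow> 'm \<Rightarrow> real" where
  "Qmax S V m = theta S V m + Amax S m"

definition drift_const :: "('m::finite, 'k::finite, 'y) plant \<Rightarrow> real" where
  "drift_const S = 1/2 * (\<Sum>m\<in>UNIV. max ((Amax S m)\<^sup>2) ((real (mu_max S m))\<^sup>2))"

definition lyapunov :: "('m::finite \<Rightarrow> real) \<Rightarrow> ('m \<Rightarrow> int) \<Rightarrow> real" where
  "lyapunov \<theta> q = 1/2 * (\<Sum>m\<in>UNIV. (real_of_int (q m) - \<theta> m)\<^sup>2)"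

text \<open>The sigma-algebra of \<open>\<hat>H\<^sub>T(t)\<close>: the states before slot \<open>t + T\<close> and the queues up to slot \<open>t\<close>.\<close>

definition history ::
  "'w measure \<Rightarrow> (nat \<Rightarrow> 'w \<Rightarrow> 'x) \<Rightarrow> (nat \<Rightarrow> 'w \<Rightarrow> 'y) \<Rightarrow> (nat \<Rightarrow> 'w \<Rightarrow> 'm \<Rightarrow> int) \<Rightarrow> nat \<Rightarrow> nat \<Rightarrow>
   'w measure" where
  "history M X Y Q T t = sigma (space M)
     ((\<Union>s\<in>{..<t + T}. generated M (X s) (count_space UNIV) \<union> generated M (Y s) (count_space UNIV))
      \<union> queue_events M Q t)"

end

theory Submission
  imports Defs
begin

text \<open>Write \<open>\<mu>\<^sub>m\<close>, \<open>A\<^sub>m\<close> and \<open>B\<close> for \<open>mu_max\<close>, \<open>Amax\<close> and \<open>drift_const\<close>.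
  The range of the inventories has a pathwise reason. Material \<open>m\<close> is bought only while
  \<open>Q\<^sub>m \<le> \<theta>\<^sub>m\<close>, so a purchase cannot carry it beyond \<open>\<theta>\<^sub>m + A\<^sub>m\<close>. Conversely \<open>\<theta>\<close> is so large that
  below \<open>2 \<mu>\<^sub>m\<close> no price makes a product containing \<open>m\<close> attractive
  (\<open>price_objective_scarce_nonpos\<close>), while from \<open>2 \<mu>\<^sub>m\<close> upwards one slot of sales cannot lead
  below \<open>\<mu>\<^sub>m\<close>. So \<open>Q\<^sub>m \<ge> \<mu>\<^sub>m\<close> for ever (\<open>queue_bounds\<close>), no product is ever blocked, and the
  algorithm really performs the unconstrained optimisation of every slot.

  The profit bound is a Lyapunov drift argument. The drift of \<open>L(Q)\<close> minus \<open>V\<close> times the profit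
  exceeds the constant \<open>B\<close> by at most an expression linear in the demands
  (\<open>drift_minus_profit\<close>). With demands replaced by their means this expression is the
  \<open>slot_cost\<close>, and the algorithm minimises exactly that. The comparison with a lookahead policy
  is made separately on every outcome: inventories and states are then constants, and only the
  randomness of the lookahead policy is averaged out. Its slot costs average to \<open>- V\<close> times its
  expected profit plus \<open>\<Sum>\<^sub>m (Q\<^sub>m(t) - \<theta>\<^sub>m) g\<^sub>m(t)\<close>, where \<open>g\<^sub>m(t)\<close> is its expected net supply. Since the
  \<open>g\<^sub>m(t)\<close> add up to zero over a frame, only the movement of \<open>Q\<close> within the frame contributes, at
  most \<open>B T (T - 1)\<close> (\<open>lookahead_frame_bound\<close>); together with \<open>B\<close> per slot this is \<open>B T\<^sup>2\<close> per
  frame. Summing over the frames telescopes the Lyapunov function.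

  Conditioning enters in two places. A demand may be replaced by its mean when it is weighted
  by something known at the time of the decision (\<open>integral_demand\<close>). And the history of the
  theorem is known in every slot, so the drift inequality may be integrated over each of its events
  (\<open>expected_drift\<close>, \<open>expected_profit_ge\<close>), which yields the almost sure inequality. For this
  the lookahead values must be integrable functions of the history. They are bounded, since the profit of
  a slot is bounded and the supremum is not over the empty set: trading nothing balances all materials
  (\<open>lookahead_policies_nonempty\<close>), and they are measurable because the states have only countably many
  trajectories over finitely many slots (\<open>state_function_measurable_history\<close>).\<close>

section \<open>Mean demands, prices and purchases\<close>

lemma mean_demand_eq_sum:
  assumes "valid_plant S" "p \<in> prices S k" "y \<in> demand_states S"
  shows "mean_demand S k p y = (\<Sum>d\<le>Dmax S k. real d * pmf (demand_dist S k p y) d)"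
proof -
  have "set_pmf (demand_dist S k p y) \<subseteq> {..Dmax S k}"
    using assms by (auto simp: valid_plant_def)
  then show ?thesis
    unfolding mean_demand_def by (subst integral_measure_pmf_real[where A = "{..Dmax S k}"]) auto
qed

lemma mean_demand_nonneg: "mean_demand S k p y \<ge> 0"
  unfolding mean_demand_def by simp

lemma mean_demand_le_Dmax:
  assumes "valid_plant S" "p \<in> prices S k" "y \<in> demand_states S"
  shows "mean_demand S k p y \<le> Dmax S k"
proof -
  have sub: "set_pmf (demand_dist S k p y) \<subseteq> {..Dmax S k}"
    using assms by (auto simp: valid_plant_def)
  have "mean_demand S k p y
      \<le> (\<Sum>d\<le>Dmax S k. real (Dmax S k) * pmf (demand_dist S k p y) d)"
    unfolding mean_demand_eq_sum[OF assms] by (intro sum_mono mult_right_mono) auto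
  also have "\<dots> = Dmax S k"
    using sum_pmf_eq_1[OF _ sub] by (simp flip: sum_distrib_left)
  finally show ?thesis .
qed

lemma prices_bounds:
  assumes "valid_plant S" "p \<in> prices S k"
  shows "0 \<le> p" "p \<le> Pmax S k"
proof -
  show "0 \<le> p"
    using assms by (auto simp: valid_plant_def)
  have "compact (prices S k)"
    using assms(1) by (simp add: valid_plant_def)
  then have "bdd_above (prices S k)"
    by (intro bounded_imp_bdd_above compact_imp_bounded)
  then show "p \<le> Pmax S k"
    using assms(2) by (auto simp: Pmax_def intro: cSup_upper)
qed

lemma purchase_cost_nonneg:
  assumes "valid_plant S" "x \<in> supply_states S" "a \<in> purchases S x"
  shows "purchase_cost a x \<ge> 0"
  using assms unfolding purchase_cost_def valid_plant_def purchases_def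
  by (intro sum_nonneg mult_nonneg_nonneg) auto

lemma purchases_update_zero:
  assumes "valid_plant S" "x \<in> supply_states S" "a \<in> purchases S x"
  shows "a(m := 0) \<in> purchases S x" "purchase_cost (a(m := 0)) x \<le> purchase_cost a x"
proof -
  show le: "purchase_cost (a(m := 0)) x \<le> purchase_cost a x"
    using assms unfolding purchase_cost_def valid_plant_def purchases_def
    by (intro sum_mono mult_left_mono) auto
  have "\<And>i. 0 \<le> a i" "\<And>i. a i \<le> min (Amax S i) (snd x i)"
    using assms(3) by (auto simp: purchases_def)
  moreover from this[of m] have "0 \<le> min (Amax S m) (snd x m)"
    by (meson of_int_0_le_iff order_trans)
  ultimately show "a(m := 0) \<in> purchases S x"
    using le assms(3) unfolding purchases_def by auto
qed

lemma Amax_nonneg: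
  assumes "a \<in> purchases S x"
  shows "Amax S m \<ge> 0"
proof -
  have "0 \<le> a m" "real_of_int (a m) \<le> min (Amax S m) (snd x m)"
    using assms by (auto simp: purchases_def)
  then show ?thesis by linarith
qed

lemma theta_ge:
  fixes S :: "('m::finite, 'k::finite, 'y) plant"
  assumes "beta S m k > 0"
  shows "V * (Pmax S k - alpha S k) / real (beta S m k)
       + (\<Sum>i\<in>UNIV - {m}. real (beta S i k) * Amax S i / real (beta S m k))
       + 2 * real (mu_max S m) \<le> theta S V m"
  unfolding theta_def using assms by (intro Max_ge) auto

section \<open>Confinement of the inventories\<close>

text \<open>This is what the choice of \<open>\<theta>\<close> achieves: the pull \<open>\<beta>\<^sub>m\<^sub>k (Q\<^sub>m - \<theta>\<^sub>m)\<close> of a single scarce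
  material outweighs the largest revenue together with the contributions of all other materials,
  each of which exceeds its own target by at most one purchase.\<close>

lemma price_objective_scarce_nonpos:
  fixes S :: "('m::finite, 'k::finite, 'y) plant"
  assumes "V > 0" "valid_plant S" "p \<in> prices S k" "beta S m k > 0"
    and scarce: "real_of_int (q m) < 2 * mu_max S m"
    and upper: "\<And>i. real_of_int (q i) \<le> theta S V i + Amax S i"
  shows "price_objective S V (theta S V) q y k p \<le> 0"
proof -
  let ?b = "real (beta S m k)"
  have b: "?b > 0" using assms by simp
  define R where "R = (\<Sum>i\<in>UNIV - {m}. real (beta S i k) * Amax S i)"
  have "(V * (Pmax S k - alpha S k) / ?b + R / ?b + 2 * mu_max S m) * ?b \<le> theta S V m * ?b"
    using theta_ge[OF assms(4), of V] b unfolding R_def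
    by (intro mult_right_mono) (auto simp: sum_divide_distrib)
  then have th: "V * (Pmax S k - alpha S k) + R + 2 * mu_max S m * ?b \<le> theta S V m * ?b"
    using b by (simp add: distrib_right)
  have "(\<Sum>i\<in>UNIV. real (beta S i k) * (q i - theta S V i))
      = ?b * (q m - theta S V m) + (\<Sum>i\<in>UNIV - {m}. real (beta S i k) * (q i - theta S V i))"
    by (simp add: sum.remove)
  also have "(\<Sum>i\<in>UNIV - {m}. real (beta S i k) * (q i - theta S V i)) \<le> R"
    unfolding R_def using upper by (intro sum_mono mult_left_mono) (auto simp: algebra_simps)
  also have "?b * (q m - theta S V m) \<le> ?b * (2 * mu_max S m - theta S V m)"
    using scarce b by (intro mult_left_mono) auto
  finally have "(\<Sum>i\<in>UNIV. real (beta S i k) * (q i - theta S V i))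
      \<le> ?b * (2 * mu_max S m - theta S V m) + R" by simp
  moreover have "V * (p - alpha S k) \<le> V * (Pmax S k - alpha S k)"
    using prices_bounds(2)[OF assms(2,3)] \<open>V > 0\<close> by simp
  ultimately have "V * (p - alpha S k) + (\<Sum>i\<in>UNIV. real (beta S i k) * (q i - theta S V i)) \<le> 0"
    using th by (simp add: algebra_simps)
  then have "mean_demand S k p y *
      (V * (p - alpha S k) + (\<Sum>i\<in>UNIV. real (beta S i k) * (q i - theta S V i))) \<le> 0"
    using mean_demand_nonneg[of S k p y] by (rule mult_nonneg_nonpos[rotated])
  then show ?thesis
    by (simp add: price_objective_def algebra_simps)
qed

context operation
begin

lemma states_mem:
  assumes "t \<in> I" "w \<in> space M"
  shows "X t w \<in> supply_states S" "Y t w \<in> demand_states S"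
  using X_measurable[OF assms(1)] Y_measurable[OF assms(1)] assms(2)
  by (auto dest: measurable_space)

lemma consumption_le_mu_max:
  assumes "t \<in> I" "w \<in> space M"
  shows "(\<Sum>k\<in>UNIV. int (beta S m k) * of_bool (Z t w k) * int (D t w k)) \<le> int (mu_max S m)"
  unfolding mu_max_def of_nat_sum of_nat_mult using D_bounded[OF assms]
  by (intro sum_mono mult_mono) auto

end

context jpp
begin

text \<open>Dropping the purchase of such a material stays feasible, does not raise the cost since prices are
  nonnegative, and strictly lowers the inventory term; so a minimiser cannot contain it.\<close>

lemma no_purchase_above_target:
  assumes "V > 0" "w \<in> space M" "real_of_int (Q t w m) > \<theta> m"
  shows "A t w m = 0"
proof (rule ccontr)
  assume "A t w m \<noteq> 0"
  let ?a = "(A t w)(m := 0)"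
  note A = A_feasible[OF UNIV_I assms(2), of t] and X = states_mem(1)[OF UNIV_I assms(2), of t]
  have pos: "A t w m > 0"
    using A \<open>A t w m \<noteq> 0\<close> by (auto simp: purchases_def order.strict_iff_order)
  have "(\<Sum>i\<in>UNIV. real_of_int (?a i) * (Q t w i - \<theta> i))
      = (\<Sum>i\<in>UNIV - {m}. real_of_int (A t w i) * (Q t w i - \<theta> i))"
    by (subst sum.remove[of _ m]) auto
  also have "\<dots> < (\<Sum>i\<in>UNIV. real_of_int (A t w i) * (Q t w i - \<theta> i))"
    using pos assms(3) by (subst (2) sum.remove[of _ m]) auto
  finally have "(\<Sum>i\<in>UNIV. real_of_int (?a i) * (Q t w i - \<theta> i))
      < (\<Sum>i\<in>UNIV. real_of_int (A t w i) * (Q t w i - \<theta> i))" .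
  moreover have "V * purchase_cost ?a (X t w) \<le> V * purchase_cost (A t w) (X t w)"
    using purchases_update_zero(2)[OF plant X A] \<open>V > 0\<close> by simp
  ultimately have "purchase_objective V \<theta> (Q t w) (X t w) ?a
      < purchase_objective V \<theta> (Q t w) (X t w) (A t w)"
    unfolding purchase_objective_def by linarith
  then show False
    using purchasing[OF assms(2), of t] purchases_update_zero(1)[OF plant X A]
    unfolding is_arg_min_def by blast
qed

lemma queue_bounds:
  assumes "V > 0" "\<theta> = theta S V" "w \<in> space M"
    and init: "\<And>m. int (mu_max S m) \<le> Q 0 w m \<and> real_of_int (Q 0 w m) \<le> Qmax S V m"
  shows "int (mu_max S m) \<le> Q t w m \<and> real_of_int (Q t w m) \<le> Qmax S V m"
proof (induction t arbitrary: m)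
  case 0
  show ?case using init .
next
  case (Suc t)
  define c where "c = (\<Sum>k\<in>UNIV. int (beta S m k) * of_bool (Z t w k) * int (D t w k))"
  have upd: "Q (Suc t) w m = Q t w m - c + A t w m"
    unfolding c_def by (rule queue_update[OF assms(3)])
  have c: "0 \<le> c" "c \<le> int (mu_max S m)"
    unfolding c_def using consumption_le_mu_max[OF UNIV_I assms(3)] by (auto intro!: sum_nonneg)
  have A: "0 \<le> A t w m" "A t w m \<le> Amax S m"
    using A_feasible[OF UNIV_I assms(3), of t] by (auto simp: purchases_def)
  (* Either m is scarce, and then nothing containing it is sold, or the stock survives the largest
     possible sale. *)
  have "int (mu_max S m) \<le> Q (Suc t) w m"
  proof (cases "Q t w m < 2 * int (mu_max S m)")
    case True
    have "\<not> Z t w k" if "beta S m k > 0" for k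
    proof (cases "blocked S (Q t w) k")
      case True
      then show ?thesis using not_offered assms(3) by blast
    next
      case False
      then have "P t w k \<in> prices S k"
        using pricing[OF assms(3)] by (auto simp: is_arg_max_def)
      moreover have "real_of_int (Q t w m) < 2 * real (mu_max S m)"
        using True by linarith
      ultimately have "price_objective S V (theta S V) (Q t w) (Y t w) k (P t w k) \<le> 0"
        using that assms(1) plant Suc by (intro price_objective_scarce_nonpos) (auto simp: Qmax_def)
      then show ?thesis using offering[OF assms(3) False] assms(2) by auto
    qed
    then have "c = 0"
      unfolding c_def by (intro sum.neutral) (metis mult_eq_0_iff neq0_conv of_bool_eq(1) of_nat_0)
    then show ?thesis using upd A(1) Suc[of m] by linarith
  next
    case False
    then show ?thesis using upd c A by linarith
  qed
  moreover have "real_of_int (Q (Suc t) w m) \<le> Qmax S V m"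
  proof (cases "real_of_int (Q t w m) > \<theta> m")
    case True
    then have "A t w m = 0" using no_purchase_above_target assms by blast
    then show ?thesis using upd c(1) Suc[of m] by simp
  next
    case False
    then show ?thesis using upd c(1) A(2) assms(2) unfolding Qmax_def by simp
  qed
  ultimately show ?case ..
qed

end

section \<open>Growth of the inventory bound\<close>

lemma Max_bigo:
  fixes f :: "'k \<Rightarrow> real \<Rightarrow> real"
  assumes "finite K" "K \<noteq> {}" "\<And>k. k \<in> K \<Longrightarrow> f k \<in> O[at_top](g)"
  shows "(\<lambda>v. Max ((\<lambda>k. f k v) ` K)) \<in> O[at_top](g)"
proof -
  have "(\<lambda>v. \<Sum>k\<in>K. \<bar>f k v\<bar>) \<in> O[at_top](g)"
    using assms(3) by (intro big_sum_in_bigo) simp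
  moreover have "\<bar>Max ((\<lambda>k. f k v) ` K)\<bar> \<le> (\<Sum>k\<in>K. \<bar>f k v\<bar>)" for v
  proof -
    have "Max ((\<lambda>k. f k v) ` K) \<in> (\<lambda>k. f k v) ` K"
      using assms by (intro Max_in) auto
    then obtain k where "k \<in> K" "Max ((\<lambda>k. f k v) ` K) = f k v" by auto
    then show ?thesis
      using member_le_sum[of k K "\<lambda>k. \<bar>f k v\<bar>"] assms(1) by simp
  qed
  then have "(\<lambda>v. Max ((\<lambda>k. f k v) ` K)) \<in> O[at_top](\<lambda>v. \<Sum>k\<in>K. \<bar>f k v\<bar>)"
    by (intro bigoI[where c = 1] always_eventually allI) (simp add: sum_nonneg)
  ultimately show ?thesis
    by (rule landau_o.big_trans[rotated])
qed

lemma Qmax_bigo: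
  fixes S :: "('m::finite, 'k::finite, 'y) plant"
  assumes "valid_plant S"
  shows "(\<lambda>v. Qmax S v m) \<in> O[at_top](\<lambda>v. v)"
proof -
  have const: "(\<lambda>_. c) \<in> O[at_top](\<lambda>v. v)" for c :: real
    by (rule bigoI[where c = "\<bar>c\<bar>"])
      (auto simp: mult_le_cancel_left1 eventually_at_top_linorder intro!: exI[of _ 1])
  have "(\<lambda>v. theta S v m) \<in> O[at_top](\<lambda>v. v)"
    unfolding theta_def
  proof (rule Max_bigo)
    show "{k. beta S m k > 0} \<noteq> {}"
      using assms by (auto simp: valid_plant_def)
    show "(\<lambda>v. v * (Pmax S k - alpha S k) / real (beta S m k)
        + (\<Sum>i\<in>UNIV - {m}. real (beta S i k) * Amax S i / real (beta S m k))
        + 2 * real (mu_max S m)) \<in> O[at_top](\<lambda>v. v)" for k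
      by (intro sum_in_bigo const) (simp add: mult.commute[of _ "_ - _"] flip: times_divide_eq_left)
  qed auto
  then show ?thesis
    unfolding Qmax_def by (intro sum_in_bigo const)
qed

section \<open>Replacing demands by their means\<close>

lemma generated_subset:
  assumes "f \<in> M \<rightarrow>\<^sub>M count_space C"
  shows "generated M f (count_space UNIV) \<subseteq> sets M"
proof -
  have "f -` B \<inter> space M \<in> sets M" for B
  proof -
    have "f -` B \<inter> space M = f -` (B \<inter> C) \<inter> space M"
      using measurable_space[OF assms] by auto
    then show ?thesis using measurable_sets[OF assms, of "B \<inter> C"] by simp
  qed
  then show ?thesis
    unfolding generated_def by (subst sets_vimage_algebra2) auto
qed

lemma generated_subset_borel:
  assumes "f \<in> borel_measurable M"
  shows "generated M f borel \<subseteq> sets M"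
  using assms unfolding generated_def by (intro sets_image_in_sets) auto

lemma measurable_generated:
  assumes "space F = space M" "generated M f N \<subseteq> sets F" "f \<in> space M \<rightarrow> space N"
  shows "f \<in> F \<rightarrow>\<^sub>M N"
proof (rule measurableI)
  show "f w \<in> space N" if "w \<in> space F" for w
    using that assms by auto
  show "f -` B \<inter> space F \<in> sets F" if "B \<in> sets N" for B
    using assms(1) subsetD[OF assms(2)[unfolded generated_def] in_vimage_algebra[OF that]] by simp
qed

lemma generated_subset_Pow: "generated M f N \<subseteq> Pow (space M)"
  using sets.space_closed[of "vimage_algebra (space M) f N"] unfolding generated_def by simp

context operation
begin

lemma sets_information:
  assumes "t \<in> I"
  shows "sets (information M I E X Y A Z P D t) = sigma_sets (space M)
     (E t \<union>
      (\<Union>s\<in>I. generated M (X s) (count_space UNIV) \<union> generated M (Y s) (count_space UNIV)) \<union>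
      (\<Union>s\<in>I \<inter> {..t}. generated M (A s) (count_space UNIV) \<union>
         generated M (Z s) (count_space UNIV) \<union> (\<Union>k. generated M (\<lambda>w. P s w k) borel)) \<union>
      (\<Union>s\<in>I \<inter> {..<t}. generated M (D s) (count_space UNIV)))"
  unfolding information_def
  by (intro sets_measure_of Un_least UN_least generated_subset_Pow
      order_trans[OF E_events[OF assms] sets.space_closed])

lemma space_information [simp]: "space (information M I E X Y A Z P D t) = space M"
  unfolding information_def by (simp add: space_measure_of_conv)

lemma subalgebra_information:
  assumes "t \<in> I"
  shows "subalgebra M (information M I E X Y A Z P D t)"
proof -
  have gen: "generated M (X s) (count_space UNIV) \<subseteq> sets M" "generated M (Y s) (count_space UNIV) \<subseteq> sets M"
    "generated M (A s) (count_space UNIV) \<subseteq> sets M" "generated M (Z s) (count_space UNIV) \<subseteq> sets M"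
    "generated M (D s) (count_space UNIV) \<subseteq> sets M" "generated M (\<lambda>w. P s w k) borel \<subseteq> sets M"
    if "s \<in> I" for s k
    using that by (rule generated_subset[OF X_measurable] generated_subset[OF Y_measurable]
        generated_subset[OF A_measurable] generated_subset[OF Z_measurable]
        generated_subset[OF D_measurable] generated_subset_borel[OF P_measurable])+
  then show ?thesis
    unfolding subalgebra_def sets_information[OF assms]
    by (intro conjI sets.sigma_sets_subset Un_least UN_least E_events[OF assms] gen) auto
qed

lemma generated_information:
  assumes "t \<in> I"
  shows "E t \<subseteq> sets (information M I E X Y A Z P D t)"
    "s \<in> I \<Longrightarrow> generated M (X s) (count_space UNIV) \<subseteq> sets (information M I E X Y A Z P D t)"
    "s \<in> I \<Longrightarrow> generated M (Y s) (count_space UNIV) \<subseteq> sets (information M I E X Y A Z P D t)"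
    "generated M (A t) (count_space UNIV) \<subseteq> sets (information M I E X Y A Z P D t)"
    "generated M (Z t) (count_space UNIV) \<subseteq> sets (information M I E X Y A Z P D t)"
    "generated M (\<lambda>w. P t w k) borel \<subseteq> sets (information M I E X Y A Z P D t)"
  unfolding sets_information[OF assms]
  by (rule order_trans[OF _ sigma_sets_superset_generator], use assms in blast)+

lemma decisions_measurable_information:
  assumes "t \<in> I"
  shows "A t \<in> information M I E X Y A Z P D t \<rightarrow>\<^sub>M count_space UNIV"
    "Z t \<in> information M I E X Y A Z P D t \<rightarrow>\<^sub>M count_space UNIV"
    "(\<lambda>w. P t w k) \<in> borel_measurable (information M I E X Y A Z P D t)"
  by (rule measurable_generated[OF _ generated_information(4)[OF assms]]
      measurable_generated[OF _ generated_information(5)[OF assms]]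
      measurable_generated[OF _ generated_information(6)[OF assms]]; simp)+

text \<open>The mean demand is only assumed continuous in the price for each fixed demand state; countability of
  the demand states makes its value at the chosen price measurable.\<close>

lemma mean_demand_measurable:
  assumes "valid_plant S" "t \<in> I"
  shows "(\<lambda>w. mean_demand S k (P t w k) (Y t w)) \<in> borel_measurable M"
proof (rule measurable_compose_countable'[OF _ Y_measurable[OF assms(2)]])
  show "countable (demand_states S)"
    using assms(1) by (simp add: valid_plant_def)
next
  fix y assume "y \<in> demand_states S"
  then have "continuous_on (prices S k) (\<lambda>p. mean_demand S k p y)"
    using assms(1) by (simp add: valid_plant_def)
  then have "(\<lambda>p. mean_demand S k p y) \<in> borel_measurable (restrict_space borel (prices S k))"
    by (rule borel_measurable_continuous_on_restrict)
  moreover have "(\<lambda>w. P t w k) \<in> M \<rightarrow>\<^sub>M restrict_space borel (prices S k)"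
    using P_feasible[OF assms(2)] by (intro measurable_restrict_space2 P_measurable assms) auto
  ultimately show "(\<lambda>w. mean_demand S k (P t w k) y) \<in> borel_measurable M"
    using measurable_compose[of "\<lambda>w. P t w k" M _ "\<lambda>p. mean_demand S k p y"] by blast
qed

lemma integrable_bounded:
  fixes f :: "'w \<Rightarrow> real"
  assumes "f \<in> borel_measurable M" "\<And>w. w \<in> space M \<Longrightarrow> \<bar>f w\<bar> \<le> c"
  shows "integrable M f"
  using assms by (intro integrable_const_bound[where B = c]) auto

text \<open>The conditional law of the demands enters the profit estimate in this form. It suffices to
  integrate against known weights, since both the drift and the profit are linear in the demands
  once the square of the inventory change is estimated by a constant.\<close>

lemma integral_demand:
  assumes "valid_plant S" "t \<in> I"
    and h: "h \<in> borel_measurable (information M I E X Y A Z P D t)"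
    and bound: "\<And>w. w \<in> space M \<Longrightarrow> \<bar>h w\<bar> \<le> c"
  shows "(\<integral>w. h w * real (D t w k) \<partial>M) = (\<integral>w. h w * mean_demand S k (P t w k) (Y t w) \<partial>M)"
proof -
  define F where "F = information M I E X Y A Z P D t"
  interpret finite_measure_subalgebra M F
    unfolding F_def by (unfold_locales) (rule subalgebra_information[OF assms(2)])
  note D_measurable[OF assms(2), measurable]
  have hF: "h \<in> borel_measurable F" using h by (simp add: F_def)
  have [measurable]: "h \<in> borel_measurable M"
    by (rule measurable_from_subalg[OF subalg hF])
  (* The demand is a finite combination of the events whose conditional probability is given. *)
  let ?ind = "\<lambda>d. indicator {v \<in> space M. D t v k = d} :: 'w \<Rightarrow> real"
  have ind_meas [measurable]: "?ind d \<in> borel_measurable M" for d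
  proof -
    have "{v \<in> space M. D t v k = d} = D t -` {f. f k = d} \<inter> space M" by auto
    then have "{v \<in> space M. D t v k = d} \<in> sets M"
      using measurable_sets[OF D_measurable[OF assms(2)], of "{f. f k = d}"] by simp
    then show ?thesis by simp
  qed
  have int: "integrable M (\<lambda>w. h w * ?ind d w)" for d
  proof (rule integrable_bounded[where c = c])
    fix w assume "w \<in> space M"
    then show "\<bar>h w * ?ind d w\<bar> \<le> c"
      using bound[of w] by (auto simp: indicator_def abs_mult)
  qed measurable
  have int': "integrable M (\<lambda>w. h w * real_cond_exp M F (?ind d) w)" for d
    by (rule real_cond_exp_intg(1)[OF int hF ind_meas])
  have "(\<integral>w. h w * real (D t w k) \<partial>M)
      = (\<integral>w. (\<Sum>d\<le>Dmax S k. real d * (h w * ?ind d w)) \<partial>M)"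
  proof (rule Bochner_Integration.integral_cong[OF refl])
    fix w assume w: "w \<in> space M"
    then have "(\<Sum>d\<le>Dmax S k. real d * (h w * ?ind d w))
        = (\<Sum>d\<le>Dmax S k. if d = D t w k then real d * h w else 0)"
      by (intro sum.cong) (auto simp: indicator_def)
    then show "h w * real (D t w k) = (\<Sum>d\<le>Dmax S k. real d * (h w * ?ind d w))"
      using D_bounded[OF assms(2) w, of k] by (simp add: sum.delta)
  qed
  also have "\<dots> = (\<Sum>d\<le>Dmax S k. real d * (\<integral>w. h w * real_cond_exp M F (?ind d) w \<partial>M))"
    using int by (simp add: real_cond_exp_intg(2)[OF int hF ind_meas])
  also have "\<dots> = (\<integral>w. (\<Sum>d\<le>Dmax S k. real d * (h w * real_cond_exp M F (?ind d) w)) \<partial>M)"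
    using int' by simp
  also have "\<dots> = (\<integral>w. h w * mean_demand S k (P t w k) (Y t w) \<partial>M)"
  proof (rule integral_cong_AE)
    have "AE w in M. \<forall>d\<in>{..Dmax S k}.
        real_cond_exp M F (?ind d) w = pmf (demand_dist S k (P t w k) (Y t w)) d"
      using D_law[OF assms(2)] unfolding F_def by (intro AE_finite_allI) auto
    moreover have "AE w in M. mean_demand S k (P t w k) (Y t w)
        = (\<Sum>d\<le>Dmax S k. real d * pmf (demand_dist S k (P t w k) (Y t w)) d)"
      using P_feasible[OF assms(2)] states_mem(2)[OF assms(2)]
      by (intro AE_I2 mean_demand_eq_sum assms(1)) auto
    ultimately show "AE w in M. (\<Sum>d\<le>Dmax S k. real d * (h w * real_cond_exp M F (?ind d) w))
        = h w * mean_demand S k (P t w k) (Y t w)"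
      by eventually_elim (auto simp: sum_distrib_left intro!: sum.cong)
    show "(\<lambda>w. h w * mean_demand S k (P t w k) (Y t w)) \<in> borel_measurable M"
      by (intro borel_measurable_times mean_demand_measurable assms) fact
  qed measurable
  finally show ?thesis .
qed

end

section \<open>Operations with decisions fixed in advance\<close>

lemma indep_vars_PiM_coordinates:
  assumes "\<And>i. i \<in> I \<Longrightarrow> prob_space (N i)" "I \<noteq> {}"
  shows "prob_space.indep_vars (PiM I N) N (\<lambda>i h. h i) I"
proof -
  interpret prob_space "PiM I N"
    using assms(1) by (rule prob_space_PiM)
  have "distr (PiM I N) (PiM I N) (\<lambda>h. restrict (\<lambda>i. h i) I) = distr (PiM I N) (PiM I N) (\<lambda>h. h)"
    by (intro distr_cong) (auto simp: space_PiM PiE_restrict)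
  also have "\<dots> = PiM I (\<lambda>i. distr (PiM I N) (N i) (\<lambda>h. h i))"
    using distr_PiM_component[of I N, OF assms(1)] by (simp cong: PiM_cong)
  finally show ?thesis
    using assms(2) by (subst indep_vars_iff_distr_eq_PiM') auto
qed

lemma generated_subset_sets:
  assumes "space F = space M" "f \<in> F \<rightarrow>\<^sub>M K"
  shows "generated M f K \<subseteq> sets F"
  using assms unfolding generated_def by (intro sets_image_in_sets) simp_all

lemma generated_constant:
  assumes "space F = space M" "\<And>w. w \<in> space M \<Longrightarrow> f w = c" "c \<in> space K"
  shows "generated M f K \<subseteq> sets F"
  using assms
  by (intro generated_subset_sets, simp, subst measurable_cong[where g = "\<lambda>_. c"]) simp_all

text \<open>This construction supplies the policy that never trades, without which the lookahead value
  would be meaningless. Demands of different slots are independent, so that the past carries no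
  information about the next demand. The
  demands of one slot are drawn independently across products, which is one of the joint laws that
  the model admits. The path measure is carried by the paths that respect the bounds
  everywhere, because feasibility is demanded of every path and not just of almost every one.\<close>

lemma open_loop_operation:
  fixes S :: "('m::finite, 'k::finite, 'y) plant"
  assumes "valid_plant S"
    and x: "\<And>t. t \<in> I \<Longrightarrow> x t \<in> supply_states S" and y: "\<And>t. t \<in> I \<Longrightarrow> y t \<in> demand_states S"
    and a: "\<And>t. t \<in> I \<Longrightarrow> a t \<in> purchases S (x t)"
    and p: "\<And>t k. t \<in> I \<Longrightarrow> p t k \<in> prices S k"
  obtains N where
    "operation N S I (\<lambda>_. {}) (\<lambda>t _. x t) (\<lambda>t _. y t) path_A path_Z path_P path_D"
    "\<And>h t. h \<in> space N \<Longrightarrow> t \<in> I \<Longrightarrow> path_A t h = a t \<and> path_Z t h = z t \<and> path_P t h = p t"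
proof -
  define demands where "demands = (\<lambda>t. Pi_pmf UNIV 0 (\<lambda>k. demand_dist S k (p t k) (y t)))"
  define slot where "slot = (\<lambda>t (d :: 'k \<Rightarrow> nat). (a t, z t, p t, d))"
  define C where "C = (\<lambda>t. if t \<in> I then slot t ` {d. \<forall>k. d k \<le> Dmax S k} else UNIV)"
  define L where "L = (\<lambda>t. map_pmf (slot t) (demands t))"
  define N1 where "N1 = (\<lambda>t. restrict_space (measure_pmf (L t)) (C t))"
  define N where "N = PiM UNIV N1"
  have L: "set_pmf (L t) \<subseteq> C t" for t
  proof (cases "t \<in> I")
    case True
    have "set_pmf (demand_dist S k (p t k) (y t)) \<subseteq> {..Dmax S k}" for k
      using assms(1) p[OF True] y[OF True] by (auto simp: valid_plant_def)
    then show ?thesis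
      using True unfolding L_def C_def demands_def
      by (auto simp: set_Pi_pmf PiE_dflt_def intro!: imageI)
  qed (simp add: C_def)
  have space_N1: "space (N1 t) = C t" for t
    by (simp add: N1_def space_restrict_space)
  have sets_N1: "sets (N1 t) = sets (count_space (C t))" for t
    by (auto simp: N1_def sets_restrict_space)
  have prob_N1: "prob_space (N1 t)" for t
    unfolding N1_def using L[of t]
    by (intro prob_space_restrict_space)
       (auto intro!: measure_pmf.emeasure_eq_1_AE simp: AE_measure_pmf_iff)
  have space_N: "h \<in> space N \<longleftrightarrow> (\<forall>t. h t \<in> C t)" for h
    by (simp add: N_def space_PiM space_N1 PiE_UNIV_domain Pi_iff)
  have prob_N: "prob_space N"
    unfolding N_def by (intro prob_space_PiM prob_N1)
  interpret N: prob_space N by (rule prob_N)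
  have fixed: "path_A t h = a t" "path_Z t h = z t" "path_P t h = p t" "path_D t h k \<le> Dmax S k"
    if "h \<in> space N" "t \<in> I" for h t k
  proof -
    have "h t \<in> C t" using that(1) space_N by blast
    then have "h t \<in> slot t ` {d. \<forall>k. d k \<le> Dmax S k}"
      using that(2) by (simp add: C_def)
    then show "path_A t h = a t" "path_Z t h = z t" "path_P t h = p t" "path_D t h k \<le> Dmax S k"
      by (auto simp: slot_def path_A_def path_Z_def path_P_def path_D_def)
  qed
  have D_meas: "path_D t \<in> N \<rightarrow>\<^sub>M count_space UNIV" for t
  proof -
    have "(\<lambda>v. snd (snd (snd v))) \<in> N1 t \<rightarrow>\<^sub>M count_space UNIV"
      by (subst measurable_cong_sets[OF sets_N1 refl]) simp
    then have "(\<lambda>h. snd (snd (snd (h t)))) \<in> N \<rightarrow>\<^sub>M count_space UNIV"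
      unfolding N_def by (rule measurable_compose[OF measurable_component_singleton[OF UNIV_I]])
    then show ?thesis by (simp add: path_D_def[abs_def])
  qed
  have "operation_axioms N S I (\<lambda>_. {}) (\<lambda>t _. x t) (\<lambda>t _. y t) path_A path_Z path_P path_D"
  proof
    fix t assume t: "t \<in> I"
    show "(\<lambda>_. x t) \<in> N \<rightarrow>\<^sub>M count_space (supply_states S)"
      "(\<lambda>_. y t) \<in> N \<rightarrow>\<^sub>M count_space (demand_states S)"
      using x[OF t] y[OF t] by simp_all
    show "path_A t \<in> N \<rightarrow>\<^sub>M count_space UNIV" "path_Z t \<in> N \<rightarrow>\<^sub>M count_space UNIV"
      using fixed(1,2)[OF _ t] by (simp_all cong: measurable_cong)
    show "path_D t \<in> N \<rightarrow>\<^sub>M count_space UNIV" by (rule D_meas)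
    show "{} \<subseteq> N.events" by simp
  next
    fix t k assume t: "t \<in> I"
    show "(\<lambda>w. path_P t w k) \<in> borel_measurable N"
      using fixed(3)[OF _ t] by (simp cong: measurable_cong)
  next
    fix t k h assume t: "t \<in> I" and h: "h \<in> space N"
    show "path_A t h \<in> purchases S (x t)" using fixed[OF h t] a[OF t] by simp
    show "path_P t h k \<in> prices S k" using fixed[OF h t] p[OF t] by simp
    show "path_D t h k \<le> Dmax S k" using fixed[OF h t] by simp
  next
    fix t k d assume t: "t \<in> I"
    let ?info = "information N I (\<lambda>_. {}) (\<lambda>t _. x t) (\<lambda>t _. y t) path_A path_Z path_P path_D t"
    (* All information available at slot t is a function of the coordinates before t, since states
       and decisions are constant; the coordinate t is independent of them. *)
    let ?past = "\<lambda>h. restrict h {..<t}"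
    define R where "R = vimage_algebra (space N) ?past (PiM {..<t} N1)"
    have past_space: "?past \<in> space N \<rightarrow> space (PiM {..<t} N1)"
      by (auto simp: space_N space_PiM space_N1)
    have space_R: "space R = space N" by (simp add: R_def)
    have D_R: "generated N (path_D s) (count_space UNIV) \<subseteq> sets R" if "s < t" for s
    proof (rule generated_subset_sets[OF space_R])
      have "?past \<in> R \<rightarrow>\<^sub>M PiM {..<t} N1"
        unfolding R_def by (rule measurable_vimage_algebra1[OF past_space])
      then have "(\<lambda>h. ?past h s) \<in> R \<rightarrow>\<^sub>M N1 s"
        by (rule measurable_compose[OF _ measurable_component_singleton]) (use that in simp)
      moreover have "(\<lambda>v. snd (snd (snd v))) \<in> N1 s \<rightarrow>\<^sub>M count_space UNIV"
        by (subst measurable_cong_sets[OF sets_N1 refl]) simp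
      ultimately have "(\<lambda>h. snd (snd (snd (?past h s)))) \<in> R \<rightarrow>\<^sub>M count_space UNIV"
        by (rule measurable_compose)
      then show "path_D s \<in> R \<rightarrow>\<^sub>M count_space UNIV"
        using that by (simp add: path_D_def[abs_def])
    qed
    have "sets ?info = sigma_sets (space N) (
      (\<Union>s\<in>I. generated N (\<lambda>_. x s) (count_space UNIV) \<union> generated N (\<lambda>_. y s) (count_space UNIV)) \<union>
      (\<Union>s\<in>I \<inter> {..t}. generated N (path_A s) (count_space UNIV) \<union>
         generated N (path_Z s) (count_space UNIV) \<union> (\<Union>k. generated N (\<lambda>w. path_P s w k) borel)) \<union>
      (\<Union>s\<in>I \<inter> {..<t}. generated N (path_D s) (count_space UNIV)))"
      unfolding information_def Un_empty_left
      by (intro sets_measure_of Un_least UN_least generated_subset_Pow)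
    also have "\<dots> \<subseteq> sets R"
      unfolding space_R[symmetric]
    proof (rule sets.sigma_sets_subset, intro Un_least UN_least)
      fix s assume "s \<in> I \<inter> {..t}"
      then have s: "s \<in> I" by simp
      show "generated N (path_A s) (count_space UNIV) \<subseteq> sets R"
        "generated N (path_Z s) (count_space UNIV) \<subseteq> sets R"
        "generated N (\<lambda>w. path_P s w k) borel \<subseteq> sets R" for k
        by (rule generated_constant[OF space_R], simp add: fixed s, simp)+
    qed (rule D_R generated_constant[OF space_R refl]; simp)+
    finally have info_R: "sets ?info \<subseteq> sets R" .
    have past_meas: "?past \<in> N \<rightarrow>\<^sub>M PiM {..<t} N1"
      unfolding N_def by (rule measurable_restrict_subset) simp
    have R_N: "sets R \<subseteq> sets N"
      unfolding R_def by (intro sets_image_in_sets past_meas) simp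
    have sub: "subalgebra N ?info"
      using info_R R_N by (auto simp: subalgebra_def information_def space_measure_of_conv)
    interpret F: finite_measure_subalgebra N ?info
      by unfold_locales (rule sub)
    define E where "E = {h \<in> space N. path_D t h k = d}"
    have "E = path_D t -` {f. f k = d} \<inter> space N" by (auto simp: E_def)
    then have E_meas [measurable]: "E \<in> sets N"
      using measurable_sets[OF D_meas[of t], of "{f. f k = d}"] by simp
    define B where "B = {v \<in> C t. snd (snd (snd v)) k = d}"
    have B: "B \<in> sets (N1 t)" by (auto simp: sets_N1 B_def)
    have E_B: "E = (\<lambda>h. h t) -` B \<inter> space N"
      by (auto simp: E_def B_def space_N path_D_def)
    have "N.prob E = measure (distr N (N1 t) (\<lambda>h. h t)) B"
      unfolding E_B N_def using B by (subst measure_distr) auto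
    also have "distr N (N1 t) (\<lambda>h. h t) = N1 t"
      unfolding N_def by (intro distr_PiM_component prob_N1) auto
    also have "measure (N1 t) B = measure (measure_pmf (L t)) B"
      unfolding N1_def by (rule measure_restrict_space) (auto simp: B_def)
    also have "\<dots> = measure (measure_pmf (L t)) {v. snd (snd (snd v)) k = d}"
      using L[of t] by (intro measure_pmf.finite_measure_eq_AE) (auto simp: AE_measure_pmf_iff B_def)
    also have "\<dots> = measure (measure_pmf (map_pmf (\<lambda>f. f k) (demands t))) {d}"
      unfolding L_def by (simp add: slot_def vimage_def)
    also have "\<dots> = pmf (demand_dist S k (p t k) (y t)) d"
      unfolding demands_def by (simp add: Pi_pmf_component measure_pmf_single)
    finally have prob_E: "N.prob E = pmf (demand_dist S k (p t k) (y t)) d" .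
    have ind: "N.indep_var (PiM {..<t} N1) (\<lambda>h. restrict (\<lambda>i. h i) {..<t})
        (PiM {t} N1) (\<lambda>h. restrict (\<lambda>i. h i) {t})"
      unfolding N_def by (rule prob_space.indep_var_restrict[OF prob_N[unfolded N_def]
          indep_vars_PiM_coordinates]) (auto intro: prob_N1)
    have indep: "N.prob (G \<inter> E) = N.prob G * N.prob E" if G: "G \<in> sets ?info" for G
    proof -
      from G info_R have "G \<in> sets R" by blast
      then obtain G' where G': "G' \<in> sets (PiM {..<t} N1)" "G = ?past -` G' \<inter> space N"
        unfolding R_def sets_vimage_algebra2[OF past_space] by auto
      let ?E' = "PiE {t} (\<lambda>_. B)"
      have E': "?E' \<in> sets (PiM {t} N1)" using B by (intro sets_PiM_I_finite) auto
      have E_eq: "E = (\<lambda>h. restrict h {t}) -` ?E' \<inter> space N"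
        unfolding E_B by (auto simp: PiE_iff)
      show ?thesis
        using N.indep_varD[OF ind G'(1) E'] unfolding G'(2) E_eq
        by (simp add: vimage_def Int_def conj_ac)
    qed
    have "AE h in N. real_cond_exp N ?info (indicator E) h = pmf (demand_dist S k (p t k) (y t)) d"
    proof (rule F.real_cond_exp_charact)
      fix G assume G: "G \<in> sets ?info"
      then have [measurable]: "G \<in> sets N" using sub by (auto simp: subalgebra_def)
      have "(\<integral>h\<in>G. indicator E h \<partial>N) = N.prob (G \<inter> E)"
        unfolding set_lebesgue_integral_def by (simp add: indicator_inter_arith[symmetric])
      then show "(\<integral>h\<in>G. indicator E h \<partial>N) = (\<integral>h\<in>G. pmf (demand_dist S k (p t k) (y t)) d \<partial>N)"
        using indep[OF G] prob_E by (simp add: set_lebesgue_integral_def)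
    qed (auto intro!: integrable_real_indicator simp: less_top[symmetric])
    then show "AE w in N. real_cond_exp N ?info (indicator {v \<in> space N. path_D t v k = d}) w
        = pmf (demand_dist S k (path_P t w k) (y t)) d"
      using AE_space unfolding E_def by eventually_elim (simp add: fixed(3)[OF _ t])
  qed
  then show ?thesis
    using that[of N] prob_N fixed by (simp add: operation_def)
qed

section \<open>The cost of a slot\<close>

definition mean_profit ::
  "('m::finite, 'k::finite, 'y) plant \<Rightarrow> 'm supply_state \<Rightarrow> 'y \<Rightarrow> ('m \<Rightarrow> int) \<Rightarrow> ('k \<Rightarrow> bool) \<Rightarrow>
   ('k \<Rightarrow> real) \<Rightarrow> real" where
  "mean_profit S x y a z p =
     - purchase_cost a x + (\<Sum>k\<in>UNIV. of_bool (z k) * mean_demand S k (p k) y * (p k - alpha S k))"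

definition net_supply ::
  "('m::finite, 'k::finite, 'y) plant \<Rightarrow> 'y \<Rightarrow> ('m \<Rightarrow> int) \<Rightarrow> ('k \<Rightarrow> bool) \<Rightarrow>
   ('k \<Rightarrow> real) \<Rightarrow> 'm \<Rightarrow> real" where
  "net_supply S y a z p m =
     real_of_int (a m) - (\<Sum>k\<in>UNIV. real (beta S m k) * of_bool (z k) * mean_demand S k (p k) y)"

text \<open>The algorithm minimises the first term through its purchases and maximises the subtracted sum through its
  prices and offers; \<open>slot_cost_eq\<close> exhibits the same quantity as a trade-off between
  profit and inventory.\<close>

definition slot_cost ::
  "('m::finite, 'k::finite, 'y) plant \<Rightarrow> real \<Rightarrow> ('m \<Rightarrow> real) \<Rightarrow> ('m \<Rightarrow> int) \<Rightarrow> 'm supply_state \<Rightarrow> 'y \<Rightarrow>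
   ('m \<Rightarrow> int) \<Rightarrow> ('k \<Rightarrow> bool) \<Rightarrow> ('k \<Rightarrow> real) \<Rightarrow> real" where
  "slot_cost S V \<theta> q x y a z p =
     purchase_objective V \<theta> q x a - (\<Sum>k\<in>UNIV. of_bool (z k) * price_objective S V \<theta> q y k (p k))"

lemma slot_cost_eq:
  "slot_cost S V \<theta> q x y a z p =
     - V * mean_profit S x y a z p + (\<Sum>m\<in>UNIV. (real_of_int (q m) - \<theta> m) * net_supply S y a z p m)"
proof -
  let ?F = "\<lambda>k. mean_demand S k (p k) y" and ?d = "\<lambda>m. real_of_int (q m) - \<theta> m"
  have "(\<Sum>m\<in>UNIV. ?d m * net_supply S y a z p m)
      = (\<Sum>m\<in>UNIV. real_of_int (a m) * ?d m)
        - (\<Sum>m\<in>UNIV. \<Sum>k\<in>UNIV. of_bool (z k) * (?F k * (real (beta S m k) * ?d m)))"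
    by (simp add: net_supply_def right_diff_distrib sum_subtractf sum_distrib_left mult_ac
        del: sum_of_bool_mult_eq sum_mult_of_bool_eq)
  also have "(\<Sum>m\<in>UNIV. \<Sum>k\<in>UNIV. of_bool (z k) * (?F k * (real (beta S m k) * ?d m)))
      = (\<Sum>k\<in>UNIV. of_bool (z k) * (?F k * (\<Sum>m\<in>UNIV. real (beta S m k) * ?d m)))"
    by (subst sum.swap) (simp add: sum_distrib_left)
  finally show ?thesis
    unfolding slot_cost_def purchase_objective_def price_objective_def mean_profit_def
    by (simp add: distrib_left right_diff_distrib[of V "sum f A" for f A] sum.distrib sum_distrib_left mult_ac
        del: sum_of_bool_mult_eq sum_mult_of_bool_eq)
qed

lemma mean_consumption_bounds:
  assumes "valid_plant S" "y \<in> demand_states S" "\<And>k. p k \<in> prices S k"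
  shows "0 \<le> (\<Sum>k\<in>UNIV. real (beta S m k) * of_bool (z k) * mean_demand S k (p k) y)"
    "(\<Sum>k\<in>UNIV. real (beta S m k) * of_bool (z k) * mean_demand S k (p k) y) \<le> mu_max S m"
proof -
  show "0 \<le> (\<Sum>k\<in>UNIV. real (beta S m k) * of_bool (z k) * mean_demand S k (p k) y)"
    by (intro sum_nonneg mult_nonneg_nonneg mean_demand_nonneg) auto
  have "(\<Sum>k\<in>UNIV. real (beta S m k) * of_bool (z k) * mean_demand S k (p k) y)
      \<le> (\<Sum>k\<in>UNIV. real (beta S m k) * 1 * real (Dmax S k))"
    by (intro sum_mono mult_mono mean_demand_le_Dmax assms mean_demand_nonneg) auto
  then show "(\<Sum>k\<in>UNIV. real (beta S m k) * of_bool (z k) * mean_demand S k (p k) y) \<le> mu_max S m"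
    by (simp add: mu_max_def)
qed

lemma net_supply_bound:
  assumes "valid_plant S" "y \<in> demand_states S" "\<And>k. p k \<in> prices S k" "a \<in> purchases S x"
  shows "\<bar>net_supply S y a z p m\<bar> \<le> max (Amax S m) (mu_max S m)"
proof -
  have "0 \<le> a m" "real_of_int (a m) \<le> Amax S m"
    using assms(4) by (auto simp: purchases_def)
  then show ?thesis
    using mean_consumption_bounds[OF assms(1-3), of m z] unfolding net_supply_def by linarith
qed

definition profit_bound :: "('m::finite, 'k::finite, 'y) plant \<Rightarrow> real" where
  "profit_bound S = cmax S + (\<Sum>k\<in>UNIV. real (Dmax S k) * (Pmax S k + alpha S k))"

lemma margin_bound:
  assumes "valid_plant S" "p \<in> prices S k"
  shows "\<bar>p - alpha S k\<bar> \<le> Pmax S k + alpha S k"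
proof -
  have "alpha S k \<ge> 0" using assms(1) by (simp add: valid_plant_def)
  then show ?thesis using prices_bounds[OF assms] by linarith
qed

lemma revenue_bound:
  assumes "valid_plant S" "\<And>k. p k \<in> prices S k" "\<And>k. 0 \<le> d k" "\<And>k. d k \<le> real (Dmax S k)"
    and "x \<in> supply_states S" "a \<in> purchases S x"
  shows "\<bar>- purchase_cost a x + (\<Sum>k\<in>UNIV. of_bool (z k) * d k * (p k - alpha S k))\<bar> \<le> profit_bound S"
proof -
  have "\<bar>purchase_cost a x\<bar> \<le> cmax S"
    using purchase_cost_nonneg[OF assms(1,5,6)] assms(6) by (simp add: purchases_def)
  moreover have "\<bar>\<Sum>k\<in>UNIV. of_bool (z k) * d k * (p k - alpha S k)\<bar>
      \<le> (\<Sum>k\<in>UNIV. real (Dmax S k) * (Pmax S k + alpha S k))"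
  proof (rule order_trans[OF sum_abs], rule sum_mono)
    fix k
    have "\<bar>of_bool (z k) * d k * (p k - alpha S k)\<bar> = (of_bool (z k) * d k) * \<bar>p k - alpha S k\<bar>"
      using assms(3)[of k] by (simp add: abs_mult)
    also have "\<dots> \<le> real (Dmax S k) * (Pmax S k + alpha S k)"
      using assms(3,4)[of k] margin_bound[OF assms(1,2)] by (intro mult_mono) auto
    finally show "\<bar>of_bool (z k) * d k * (p k - alpha S k)\<bar>
        \<le> real (Dmax S k) * (Pmax S k + alpha S k)" .
  qed
  ultimately show ?thesis
    unfolding profit_bound_def by linarith
qed

context operation
begin

lemma demand_measurable:
  assumes "t \<in> I"
  shows "(\<lambda>w. real (D t w k)) \<in> borel_measurable M"
  using measurable_compose[OF D_measurable[OF assms], of "\<lambda>d. real (d k)" borel] by simp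

lemma purchase_measurable:
  assumes "t \<in> I"
  shows "(\<lambda>w. real_of_int (A t w m)) \<in> borel_measurable M"
  using measurable_compose[OF A_measurable[OF assms], of "\<lambda>a. real_of_int (a m)" borel] by simp

lemma offer_measurable:
  assumes "t \<in> I"
  shows "(\<lambda>w. of_bool (Z t w k) :: real) \<in> borel_measurable M"
  using measurable_compose[OF Z_measurable[OF assms], of "\<lambda>z. of_bool (z k) :: real" borel] by simp

lemma purchase_cost_measurable:
  assumes "t \<in> I"
  shows "(\<lambda>w. purchase_cost (A t w) (X t w)) \<in> borel_measurable M"
proof -
  have "(\<lambda>w. fst (X t w) m) \<in> borel_measurable M" for m
    using measurable_compose[OF X_measurable[OF assms], of "\<lambda>x. fst x m" borel] by simp
  then show ?thesis
    unfolding purchase_cost_def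
    by (intro borel_measurable_sum borel_measurable_times purchase_measurable[OF assms])
qed

lemma profit_measurable:
  assumes "t \<in> I"
  shows "(\<lambda>w. profit S (X t w) (A t w) (Z t w) (P t w) (D t w)) \<in> borel_measurable M"
  unfolding profit_def
  by (intro borel_measurable_add borel_measurable_uminus borel_measurable_sum borel_measurable_times
      borel_measurable_diff purchase_cost_measurable offer_measurable demand_measurable P_measurable
      borel_measurable_const assms)

lemma profit_bounded:
  assumes "valid_plant S" "t \<in> I" "w \<in> space M"
  shows "\<bar>profit S (X t w) (A t w) (Z t w) (P t w) (D t w)\<bar> \<le> profit_bound S"
  unfolding profit_def using assms
  by (intro revenue_bound[where x = "X t w"] P_feasible A_feasible states_mem) (auto simp: D_bounded)

lemma integrable_profit:
  assumes "valid_plant S" "t \<in> I"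
  shows "integrable M (\<lambda>w. profit S (X t w) (A t w) (Z t w) (P t w) (D t w))"
  using assms by (intro integrable_bounded[where c = "profit_bound S"] profit_measurable profit_bounded)

lemma integrable_purchase_cost:
  assumes "valid_plant S" "t \<in> I"
  shows "integrable M (\<lambda>w. purchase_cost (A t w) (X t w))"
proof (rule integrable_bounded)
  fix w assume "w \<in> space M"
  then show "\<bar>purchase_cost (A t w) (X t w)\<bar> \<le> cmax S"
    using purchase_cost_nonneg[OF assms(1) states_mem(1)[OF assms(2)] A_feasible[OF assms(2)], of w]
      A_feasible[OF assms(2), of w] by (simp add: purchases_def)
qed (rule purchase_cost_measurable[OF assms(2)])

lemma margin_measurable_information:
  assumes "t \<in> I"
  shows "(\<lambda>w. of_bool (Z t w k) * (P t w k - alpha S k))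
    \<in> borel_measurable (information M I E X Y A Z P D t)"
  using measurable_compose[OF decisions_measurable_information(2)[OF assms],
      of "\<lambda>z. of_bool (z k) :: real" borel]
  by (intro borel_measurable_times borel_measurable_diff decisions_measurable_information(3)[OF assms]) auto

lemma integrable_times_demand:
  assumes "valid_plant S" "t \<in> I"
    and "h \<in> borel_measurable M" and bound: "\<And>w. w \<in> space M \<Longrightarrow> \<bar>h w\<bar> \<le> c"
  shows "integrable M (\<lambda>w. h w * real (D t w k))"
    "integrable M (\<lambda>w. h w * mean_demand S k (P t w k) (Y t w))"
proof -
  have *: "\<bar>h w * r\<bar> \<le> c * real (Dmax S k)" if "w \<in> space M" "0 \<le> r" "r \<le> real (Dmax S k)" for w r
    unfolding abs_mult using that bound[of w] by (intro mult_mono) auto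
  show "integrable M (\<lambda>w. h w * real (D t w k))"
    using assms(2,3) *
    by (intro integrable_bounded[where c = "c * real (Dmax S k)"] borel_measurable_times demand_measurable) (auto simp: D_bounded)
  show "integrable M (\<lambda>w. h w * mean_demand S k (P t w k) (Y t w))"
    using assms(1-3)
    by (intro integrable_bounded[where c = "c * real (Dmax S k)"] borel_measurable_times
        mean_demand_measurable * mean_demand_nonneg mean_demand_le_Dmax P_feasible states_mem)
qed

lemma
  assumes "valid_plant S" "t \<in> I"
  shows integrable_mean_profit:
      "integrable M (\<lambda>w. mean_profit S (X t w) (Y t w) (A t w) (Z t w) (P t w))"
    and integral_profit:
      "(\<integral>w. profit S (X t w) (A t w) (Z t w) (P t w) (D t w) \<partial>M)
       = (\<integral>w. mean_profit S (X t w) (Y t w) (A t w) (Z t w) (P t w) \<partial>M)"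
proof -
  define h where "h = (\<lambda>k w. of_bool (Z t w k) * (P t w k - alpha S k))"
  have h_info: "h k \<in> borel_measurable (information M I E X Y A Z P D t)" for k
    unfolding h_def by (rule margin_measurable_information[OF assms(2)])
  have h_bound: "\<bar>h k w\<bar> \<le> Pmax S k + alpha S k" if "w \<in> space M" for k w
    using margin_bound[OF assms(1) P_feasible[OF assms(2) that]] unfolding h_def
    by (auto intro: order_trans[OF abs_ge_zero])
  have h_meas: "h k \<in> borel_measurable M" for k
    by (rule measurable_from_subalg[OF subalgebra_information[OF assms(2)] h_info])
  have int: "integrable M (\<lambda>w. h k w * real (D t w k))"
    "integrable M (\<lambda>w. h k w * mean_demand S k (P t w k) (Y t w))" for k
    by (rule integrable_times_demand[OF assms h_meas]; erule h_bound)+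
  have swap: "(\<integral>w. h k w * real (D t w k) \<partial>M)
      = (\<integral>w. h k w * mean_demand S k (P t w k) (Y t w) \<partial>M)" for k
    by (rule integral_demand[OF assms h_info]) (erule h_bound)
  note int = int integrable_purchase_cost[OF assms]
  have mean: "mean_profit S (X t w) (Y t w) (A t w) (Z t w) (P t w)
      = - purchase_cost (A t w) (X t w) + (\<Sum>k\<in>UNIV. h k w * mean_demand S k (P t w k) (Y t w))" for w
    by (simp add: mean_profit_def h_def mult_ac)
  show "integrable M (\<lambda>w. mean_profit S (X t w) (Y t w) (A t w) (Z t w) (P t w))"
    unfolding mean using int by (intro Bochner_Integration.integrable_add integrable_minus Bochner_Integration.integrable_sum)
  have "profit S (X t w) (A t w) (Z t w) (P t w) (D t w)
      = - purchase_cost (A t w) (X t w) + (\<Sum>k\<in>UNIV. h k w * real (D t w k))" for w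
    by (simp add: profit_def h_def mult_ac)
  then show "(\<integral>w. profit S (X t w) (A t w) (Z t w) (P t w) (D t w) \<partial>M)
       = (\<integral>w. mean_profit S (X t w) (Y t w) (A t w) (Z t w) (P t w) \<partial>M)"
    unfolding mean using int swap by simp
qed

lemma integrable_net_supply:
  assumes "valid_plant S" "t \<in> I"
  shows "integrable M (\<lambda>w. net_supply S (Y t w) (A t w) (Z t w) (P t w) m)"
proof (rule integrable_bounded)
  show "(\<lambda>w. net_supply S (Y t w) (A t w) (Z t w) (P t w) m) \<in> borel_measurable M"
    unfolding net_supply_def
    by (intro borel_measurable_diff borel_measurable_sum borel_measurable_times purchase_measurable
        offer_measurable mean_demand_measurable borel_measurable_const assms)
next
  fix w assume "w \<in> space M"
  then show "\<bar>net_supply S (Y t w) (A t w) (Z t w) (P t w) m\<bar> \<le> max (Amax S m) (mu_max S m)"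
    using assms by (intro net_supply_bound[where x = "X t w"] states_mem P_feasible A_feasible)
qed

text \<open>In the application \<open>\<psi>\<close> is the algorithm's own slot cost on a single outcome, and \<open>q\<close> are its
  inventories there; both are constants for the competing policy, over which the expectation
  is taken.\<close>

lemma slot_cost_le_expectation:
  assumes "valid_plant S" "t \<in> I"
    and le: "\<And>w. w \<in> space M \<Longrightarrow> \<psi> \<le> slot_cost S V \<theta> q (X t w) (Y t w) (A t w) (Z t w) (P t w)"
  shows "\<psi> \<le> - V * (\<integral>w. profit S (X t w) (A t w) (Z t w) (P t w) (D t w) \<partial>M)
    + (\<Sum>m\<in>UNIV. (real_of_int (q m) - \<theta> m) * (\<integral>w. net_supply S (Y t w) (A t w) (Z t w) (P t w) m \<partial>M))"
proof -
  note int = integrable_mean_profit[OF assms(1,2)] integrable_net_supply[OF assms(1,2)]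
  have "\<psi> \<le> (\<integral>w. slot_cost S V \<theta> q (X t w) (Y t w) (A t w) (Z t w) (P t w) \<partial>M)"
    using int le unfolding slot_cost_eq by (intro integral_ge_const AE_I2) auto
  also have "\<dots> = - V * (\<integral>w. mean_profit S (X t w) (Y t w) (A t w) (Z t w) (P t w) \<partial>M)
    + (\<Sum>m\<in>UNIV. (real_of_int (q m) - \<theta> m) * (\<integral>w. net_supply S (Y t w) (A t w) (Z t w) (P t w) m \<partial>M))"
    using int unfolding slot_cost_eq by simp
  finally show ?thesis
    unfolding integral_profit[OF assms(1,2)] .
qed

end

section \<open>The lookahead value\<close>

lemma (in operation) expected_profit_bounded:
  assumes "valid_plant S" "t \<in> I"
  shows "\<bar>\<integral>w. profit S (X t w) (A t w) (Z t w) (P t w) (D t w) \<partial>M\<bar> \<le> profit_bound S"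
proof -
  note int = integrable_profit[OF assms]
  have "\<bar>\<integral>w. profit S (X t w) (A t w) (Z t w) (P t w) (D t w) \<partial>M\<bar>
      \<le> (\<integral>w. \<bar>profit S (X t w) (A t w) (Z t w) (P t w) (D t w)\<bar> \<partial>M)"
    by (rule integral_abs_bound)
  also have "\<dots> \<le> profit_bound S"
    using int profit_bounded[OF assms] by (intro integral_le_const AE_I2) auto
  finally show ?thesis .
qed

text \<open>The states outside the frame do not matter; this is what makes the lookahead value a function of the
  states that the history records.\<close>

lemma operation_states_cong:
  assumes "operation N S I E X Y A Z P D"
    and eq: "\<And>t. t \<in> I \<Longrightarrow> X' t = X t" "\<And>t. t \<in> I \<Longrightarrow> Y' t = Y t"
  shows "operation N S I E X' Y' A Z P D"
proof -
  interpret operation N S I E X Y A Z P D by fact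
  have info: "information N I E X' Y' A Z P D t = information N I E X Y A Z P D t" for t
    using eq by (simp add: information_def cong: SUP_cong)
  show ?thesis
  proof
    fix t assume t: "t \<in> I"
    show "X' t \<in> N \<rightarrow>\<^sub>M count_space (supply_states S)" "Y' t \<in> N \<rightarrow>\<^sub>M count_space (demand_states S)"
      using X_measurable[OF t] Y_measurable[OF t] by (simp_all only: eq[OF t])
    show "A t w \<in> purchases S (X' t w)" if "w \<in> space N" for w
      using A_feasible[OF t that] by (simp only: eq[OF t])
    show "AE w in N. real_cond_exp N (information N I E X' Y' A Z P D t)
        (indicator {v \<in> space N. D t v k = d}) w = pmf (demand_dist S k (P t w k) (Y' t w)) d" for k d
      using D_law[OF t] by (simp only: info eq[OF t])
  qed (fact A_measurable Z_measurable P_measurable D_measurable E_events P_feasible D_bounded)+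
qed

lemma lookahead_value_cong:
  assumes eq: "\<And>t. t \<in> {t0..<t0 + T} \<Longrightarrow> x' t = x t" "\<And>t. t \<in> {t0..<t0 + T} \<Longrightarrow> y' t = y t"
  shows "lookahead_value S T t0 x' y' = lookahead_value S T t0 x y"
proof -
  have "operation N S {t0..<t0 + T} (\<lambda>_. {}) (\<lambda>t _. x' t) (\<lambda>t _. y' t) path_A path_Z path_P path_D
    \<longleftrightarrow> operation N S {t0..<t0 + T} (\<lambda>_. {}) (\<lambda>t _. x t) (\<lambda>t _. y t) path_A path_Z path_P path_D" for N
    by (rule iffI; erule operation_states_cong) (use eq in auto)
  then have "lookahead_policies S T t0 x' y' = lookahead_policies S T t0 x y"
    unfolding lookahead_policies_def using eq by (simp cong: sum.cong_simp)
  then show ?thesis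
    unfolding lookahead_value_def using eq by (simp cong: sum.cong_simp)
qed

lemma zero_mem_purchases:
  assumes "valid_plant S" "x \<in> supply_states S" "purchases S x \<noteq> {}"
  shows "(\<lambda>_. 0) \<in> purchases S x"
proof -
  obtain a where a: "a \<in> purchases S x" using assms(3) by blast
  have "0 \<le> min (Amax S m) (snd x m)" for m
  proof -
    have "0 \<le> real_of_int (a m)" "real_of_int (a m) \<le> min (Amax S m) (snd x m)"
      using a by (auto simp: purchases_def)
    then show ?thesis by linarith
  qed
  moreover have "0 \<le> cmax S"
    using purchase_cost_nonneg[OF assms(1,2) a] a by (simp add: purchases_def)
  ultimately show ?thesis
    by (simp add: purchases_def purchase_cost_def)
qed

text \<open>Trading nothing balances all materials. Without this the supremum in the lookahead value might
  be taken over the empty set, where it is an arbitrary number.\<close>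

lemma lookahead_policies_nonempty:
  assumes "valid_plant S"
    and "\<And>t. t \<in> {t0..<t0 + T} \<Longrightarrow> x t \<in> supply_states S"
    and "\<And>t. t \<in> {t0..<t0 + T} \<Longrightarrow> y t \<in> demand_states S"
    and "\<And>t. t \<in> {t0..<t0 + T} \<Longrightarrow> purchases S (x t) \<noteq> {}"
  shows "lookahead_policies S T t0 x y \<noteq> {}"
proof -
  have "\<exists>p. p \<in> prices S k" for k
    using assms(1) by (auto simp: valid_plant_def)
  then obtain p where p: "\<And>k. p k \<in> prices S k" by metis
  obtain N where N:
    "operation N S {t0..<t0 + T} (\<lambda>_. {}) (\<lambda>t _. x t) (\<lambda>t _. y t) path_A path_Z path_P path_D"
    and idle: "\<And>h t. h \<in> space N \<Longrightarrow> t \<in> {t0..<t0 + T} \<Longrightarrow>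
      path_A t h = (\<lambda>_. 0) \<and> path_Z t h = (\<lambda>_. False) \<and> path_P t h = p"
  proof (rule open_loop_operation[where S = S and I = "{t0..<t0 + T}" and x = x and y = y
      and a = "\<lambda>_ _. 0" and z = "\<lambda>_ _. False" and p = "\<lambda>_. p", OF assms(1-3)])
    show "(\<lambda>_. 0) \<in> purchases S (x t)" if "t \<in> {t0..<t0 + T}" for t
      using that assms by (intro zero_mem_purchases)
  qed (use p in auto)
  have "(LINT h|N. real_of_int (path_A t h m) - (\<Sum>k\<in>UNIV. real (beta S m k)
      * of_bool (path_Z t h k) * mean_demand S k (path_P t h k) (y t))) = 0"
    if "t \<in> {t0..<t0 + T}" for t m
  proof -
    have "(LINT h|N. real_of_int (path_A t h m) - (\<Sum>k\<in>UNIV. real (beta S m k)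
        * of_bool (path_Z t h k) * mean_demand S k (path_P t h k) (y t))) = (LINT h|N. 0)"
      using idle[OF _ that] by (intro Bochner_Integration.integral_cong refl) simp
    then show ?thesis by simp
  qed
  then have "N \<in> lookahead_policies S T t0 x y"
    using N by (simp add: lookahead_policies_def)
  then show ?thesis by blast
qed

lemma lookahead_value_bounded:
  assumes "valid_plant S" "lookahead_policies S T t0 x y \<noteq> {}"
  shows "\<bar>lookahead_value S T t0 x y\<bar> \<le> real T * profit_bound S"
  unfolding lookahead_value_def
proof (rule cSup_abs_le, use assms(2) in simp, safe)
  fix N assume "N \<in> lookahead_policies S T t0 x y"
  then interpret operation N S "{t0..<t0 + T}" "\<lambda>_. {}" "\<lambda>t _. x t" "\<lambda>t _. y t"
      path_A path_Z path_P path_D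
    by (simp add: lookahead_policies_def)
  have "\<bar>\<Sum>t\<in>{t0..<t0 + T}. LINT h|N. profit S (x t) (path_A t h) (path_Z t h) (path_P t h) (path_D t h)\<bar>
      \<le> (\<Sum>t\<in>{t0..<t0 + T}. profit_bound S)"
    using expected_profit_bounded[OF assms(1)] by (intro order_trans[OF sum_abs] sum_mono) auto
  then show "\<bar>\<Sum>t\<in>{t0..<t0 + T}. LINT h|N. profit S (x t) (path_A t h) (path_Z t h) (path_P t h) (path_D t h)\<bar>
      \<le> real T * profit_bound S" by simp
qed

lemma max_square:
  fixes a b :: real
  assumes "0 \<le> a" "0 \<le> b"
  shows "(max a b)\<^sup>2 = max (a\<^sup>2) (b\<^sup>2)"
  using assms by (cases "a \<le> b") (auto simp: max_def power_mono dest: power2_le_imp_le)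

text \<open>A lookahead policy balances each material over the frame, not slot by slot. Were the
  inventories \<open>q t\<close> constant on the frame, balance would remove the inventory terms of the
  comparison altogether; as they move by at most \<open>t - t0\<close> times the largest change per slot,
  what remains is quadratic in the length of the frame.\<close>

lemma lookahead_frame_bound:
  fixes S :: "('m::finite, 'k::finite, 'y) plant"
  assumes valid: "valid_plant S" and "V > 0"
    and x: "\<And>t. t \<in> {t0..<t0 + T} \<Longrightarrow> x t \<in> supply_states S"
    and y: "\<And>t. t \<in> {t0..<t0 + T} \<Longrightarrow> y t \<in> demand_states S"
    and feasible: "\<And>t. t \<in> {t0..<t0 + T} \<Longrightarrow> purchases S (x t) \<noteq> {}"
    and opt: "\<And>t a z p. t \<in> {t0..<t0 + T} \<Longrightarrow> a \<in> purchases S (x t) \<Longrightarrow>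
      (\<And>k. p k \<in> prices S k) \<Longrightarrow> \<psi> t \<le> slot_cost S V \<theta> (q t) (x t) (y t) a z p"
    and moves: "\<And>t m. t \<in> {t0..<t0 + T} \<Longrightarrow>
      \<bar>real_of_int (q t m) - real_of_int (q t0 m)\<bar> \<le> real (t - t0) * max (Amax S m) (mu_max S m)"
  shows "(\<Sum>t\<in>{t0..<t0 + T}. \<psi> t)
    \<le> - V * lookahead_value S T t0 x y + drift_const S * (real T * (real T - 1))"
proof -
  let ?I = "{t0..<t0 + T}"
  let ?B = "drift_const S * (real T * (real T - 1))"
  have "V * (\<Sum>t\<in>?I. LINT h|N. profit S (x t) (path_A t h) (path_Z t h) (path_P t h) (path_D t h))
      \<le> ?B - (\<Sum>t\<in>?I. \<psi> t)" if N: "N \<in> lookahead_policies S T t0 x y" for N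
  proof -
    interpret operation N S ?I "\<lambda>_. {}" "\<lambda>t _. x t" "\<lambda>t _. y t" path_A path_Z path_P path_D
      using N by (simp add: lookahead_policies_def)
    define g where
      "g = (\<lambda>t m. LINT h|N. net_supply S (y t) (path_A t h) (path_Z t h) (path_P t h) m)"
    define \<Phi> where
      "\<Phi> = (\<lambda>t. LINT h|N. profit S (x t) (path_A t h) (path_Z t h) (path_P t h) (path_D t h))"
    let ?c = "\<lambda>m. max (Amax S m) (real (mu_max S m))"
    have balance: "(\<Sum>t\<in>?I. g t m) = 0" for m
      using N by (simp add: lookahead_policies_def g_def net_supply_def)
    have g_bound: "\<bar>g t m\<bar> \<le> ?c m" if t: "t \<in> ?I" for t m
    proof -
      have "\<bar>g t m\<bar> \<le> (LINT h|N. \<bar>net_supply S (y t) (path_A t h) (path_Z t h) (path_P t h) m\<bar>)"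
        unfolding g_def by (rule integral_abs_bound)
      also have "\<dots> \<le> ?c m"
        using integrable_net_supply[OF valid t]
          net_supply_bound[OF valid y[OF t] P_feasible[OF t] A_feasible[OF t]]
        by (intro integral_le_const AE_I2) auto
      finally show ?thesis .
    qed
    have c_nonneg: "Amax S m \<ge> 0" if "t \<in> ?I" for t m
      using feasible[OF that] Amax_nonneg by blast
    (* Split the inventory at its value at the start of the frame. *)
    have slot: "\<psi> t + V * \<Phi> t \<le> (\<Sum>m\<in>UNIV. (real_of_int (q t0 m) - \<theta> m) * g t m)
        + real (t - t0) * (2 * drift_const S)" if t: "t \<in> ?I" for t
    proof -
      have "\<psi> t \<le> - V * \<Phi> t + (\<Sum>m\<in>UNIV. (real_of_int (q t m) - \<theta> m) * g t m)"
        unfolding \<Phi>_def g_def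
        by (intro slot_cost_le_expectation[OF valid t] opt[OF t] A_feasible[OF t] P_feasible[OF t])
      also have "(\<Sum>m\<in>UNIV. (real_of_int (q t m) - \<theta> m) * g t m)
          = (\<Sum>m\<in>UNIV. (real_of_int (q t0 m) - \<theta> m) * g t m)
            + (\<Sum>m\<in>UNIV. (real_of_int (q t m) - real_of_int (q t0 m)) * g t m)"
        unfolding sum.distrib[symmetric] by (intro sum.cong) (auto simp: algebra_simps)
      also have "(\<Sum>m\<in>UNIV. (real_of_int (q t m) - real_of_int (q t0 m)) * g t m)
          \<le> (\<Sum>m\<in>UNIV. real (t - t0) * (?c m)\<^sup>2)"
      proof (rule sum_mono)
        fix m
        have "(real_of_int (q t m) - real_of_int (q t0 m)) * g t m
            \<le> \<bar>real_of_int (q t m) - real_of_int (q t0 m)\<bar> * \<bar>g t m\<bar>"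
          by (metis abs_ge_self abs_mult)
        also have "\<dots> \<le> (real (t - t0) * ?c m) * ?c m"
          using moves[OF t] g_bound[OF t] by (intro mult_mono) auto
        finally show "(real_of_int (q t m) - real_of_int (q t0 m)) * g t m \<le> real (t - t0) * (?c m)\<^sup>2"
          by (simp add: power2_eq_square mult_ac)
      qed
      also have "\<dots> = real (t - t0) * (2 * drift_const S)"
        using c_nonneg[OF t] by (simp add: drift_const_def max_square sum_distrib_left)
      finally show ?thesis by simp
    qed
    have "(\<Sum>t\<in>?I. \<psi> t) + V * (\<Sum>t\<in>?I. \<Phi> t)
        \<le> (\<Sum>t\<in>?I. \<Sum>m\<in>UNIV. (real_of_int (q t0 m) - \<theta> m) * g t m)
          + (\<Sum>t\<in>?I. real (t - t0)) * (2 * drift_const S)"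
      using sum_mono[OF slot, of ?I] by (simp add: sum.distrib sum_distrib_left sum_distrib_right)
    also have "(\<Sum>t\<in>?I. \<Sum>m\<in>UNIV. (real_of_int (q t0 m) - \<theta> m) * g t m) = 0"
      by (subst sum.swap) (simp add: balance flip: sum_distrib_left)
    also have "(\<Sum>t\<in>?I. real (t - t0)) = (\<Sum>s<T. real s)"
      by (rule sum.reindex_bij_witness[of _ "\<lambda>s. s + t0" "\<lambda>t. t - t0"]) auto
    also have "\<dots> = real T * (real T - 1) / 2"
      by (induction T) (auto simp: field_simps)
    finally show ?thesis by (simp add: \<Phi>_def algebra_simps)
  qed
  then have "lookahead_value S T t0 x y \<le> (?B - (\<Sum>t\<in>?I. \<psi> t)) / V"
    unfolding lookahead_value_def using \<open>V > 0\<close>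
    by (intro cSUP_least lookahead_policies_nonempty valid x y feasible) (auto simp: pos_le_divide_eq mult.commute)
  then show ?thesis
    using \<open>V > 0\<close> by (simp add: pos_le_divide_eq algebra_simps)
qed

section \<open>Drift of the Lyapunov function\<close>

text \<open>Integrate over the event that the conclusion fails, which itself belongs to the subalgebra: the
  integrals there contradict the hypothesis unless the event is null.\<close>

lemma (in finite_measure_subalgebra) real_cond_exp_ge:
  assumes "integrable M f" "integrable M g" and g: "g \<in> borel_measurable F"
    and le: "\<And>G. G \<in> sets F \<Longrightarrow> (\<integral>w. indicator G w * g w \<partial>M) \<le> (\<integral>w. indicator G w * f w \<partial>M)"
  shows "AE w in M. g w \<le> real_cond_exp M F f w"
proof -
  define r where "r = real_cond_exp M F f"
  have r: "integrable M r" "r \<in> borel_measurable F"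
    unfolding r_def using real_cond_exp_int(1)[OF assms(1)] by auto
  define G where "G = {w \<in> space F. r w < g w}"
  have G: "G \<in> sets F"
    unfolding G_def using borel_measurable_less[OF r(2) g] by simp
  then have GM: "G \<in> sets M" using subalg by (auto simp: subalgebra_def)
  have int: "integrable M (\<lambda>w. indicator G w * h w)" if "integrable M h" for h :: "'a \<Rightarrow> real"
    using integrable_mult_indicator[OF GM that] by simp
  have "(\<integral>w. indicator G w * r w \<partial>M) = (\<integral>w. indicator G w * f w \<partial>M)"
    using real_cond_exp_intA[OF assms(1) G] by (simp add: set_lebesgue_integral_def r_def)
  then have "(\<integral>w. indicator G w * (g w - r w) \<partial>M) \<le> 0"
    using le[OF G] int[OF assms(2)] int[OF r(1)] by (simp add: right_diff_distrib)
  moreover have nonneg: "0 \<le> indicator G w * (g w - r w)" for w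
    by (auto simp: indicator_def G_def)
  ultimately have "(\<integral>w. indicator G w * (g w - r w) \<partial>M) = 0"
    by (intro antisym integral_nonneg) auto
  moreover have "integrable M (\<lambda>w. indicator G w * (g w - r w))"
    using assms(2) r(1) by (intro int) auto
  ultimately have "AE w in M. indicator G w * (g w - r w) = 0"
    using nonneg by (subst (asm) integral_nonneg_eq_0_iff_AE) auto
  moreover have "space F = space M" using subalg by (simp add: subalgebra_def)
  ultimately show ?thesis
    unfolding r_def[symmetric] using AE_space[of M]
    by (elim AE_mp, intro AE_I2) (auto simp: G_def indicator_def not_less split: if_splits)
qed

lemma lyapunov_diff:
  assumes "\<And>m. real_of_int (q' m) = real_of_int (q m) + \<delta> m"
  shows "lyapunov \<theta> q' - lyapunov \<theta> q
    = (\<Sum>m\<in>UNIV. (real_of_int (q m) - \<theta> m) * \<delta> m) + 1/2 * (\<Sum>m\<in>UNIV. (\<delta> m)\<^sup>2)"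
proof -
  have "(real_of_int (q' m) - \<theta> m)\<^sup>2
      = (real_of_int (q m) - \<theta> m)\<^sup>2 + 2 * ((real_of_int (q m) - \<theta> m) * \<delta> m) + (\<delta> m)\<^sup>2" for m
    unfolding assms by (simp add: power2_eq_square algebra_simps)
  then show ?thesis
    by (simp add: lyapunov_def sum.distrib add_divide_distrib flip: sum_distrib_left)
qed

locale started_jpp = jpp M S X Y Q A Z P D V \<theta>
  for M :: "'w measure"
    and S :: "('m::finite, 'k::finite, 'y) plant"
    and X Y Q A Z P D V \<theta> +
  assumes V_pos: "V > 0"
    and theta: "\<theta> = theta S V"
    and start: "w \<in> space M \<Longrightarrow> int (mu_max S m) \<le> Q 0 w m \<and> real_of_int (Q 0 w m) \<le> Qmax S V m"
begin

lemma queue_range: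
  assumes "w \<in> space M"
  shows "int (mu_max S m) \<le> Q t w m" "real_of_int (Q t w m) \<le> \<theta> m + Amax S m"
  using queue_bounds[OF V_pos theta assms start[OF assms], of m t] theta by (auto simp: Qmax_def)

lemma not_blocked:
  assumes "w \<in> space M"
  shows "\<not> blocked S (Q t w) k"
  using queue_range(1)[OF assms] by (auto simp: blocked_def not_less)

lemma Amax_nonneg: "Amax S m \<ge> 0"
  using not_empty A_feasible[OF UNIV_I, of _ undefined] Amax_nonneg[of _ S] by blast

definition slot_cost_of :: "nat \<Rightarrow> 'w \<Rightarrow> real" where
  "slot_cost_of t w = slot_cost S V \<theta> (Q t w) (X t w) (Y t w) (A t w) (Z t w) (P t w)"

text \<open>The competing decision is subject to no inventory constraint. This is where it matters that the
  inventories keep every product unblocked: otherwise the algorithm could be forced to refuse a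
  product that the competitor offers.\<close>

lemma slot_cost_minimal:
  assumes "w \<in> space M" "a \<in> purchases S (X t w)" "\<And>k. p k \<in> prices S k"
  shows "slot_cost_of t w \<le> slot_cost S V \<theta> (Q t w) (X t w) (Y t w) a z p"
proof -
  have "purchase_objective V \<theta> (Q t w) (X t w) (A t w) \<le> purchase_objective V \<theta> (Q t w) (X t w) a"
    using purchasing[OF assms(1), of t] assms(2) by (auto simp: is_arg_min_def not_less)
  moreover have "of_bool (z k) * price_objective S V \<theta> (Q t w) (Y t w) k (p k)
      \<le> of_bool (Z t w k) * price_objective S V \<theta> (Q t w) (Y t w) k (P t w k)" for k
  proof -
    have "price_objective S V \<theta> (Q t w) (Y t w) k (p k)
        \<le> price_objective S V \<theta> (Q t w) (Y t w) k (P t w k)"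
      using pricing[OF assms(1) not_blocked[OF assms(1)], of t k] assms(3)
      by (auto simp: is_arg_max_def not_less)
    then show ?thesis
      using offering[OF assms(1) not_blocked[OF assms(1)], of t k] by (cases "z k") auto
  qed
  ultimately show ?thesis
    unfolding slot_cost_of_def slot_cost_def by (intro diff_mono sum_mono)
qed

definition consumption :: "nat \<Rightarrow> 'w \<Rightarrow> 'm \<Rightarrow> real" where
  "consumption t w m = (\<Sum>k\<in>UNIV. real (beta S m k) * of_bool (Z t w k) * real (D t w k))"

lemma queue_update_real:
  assumes "w \<in> space M"
  shows "real_of_int (Q (Suc t) w m)
    = real_of_int (Q t w m) + (real_of_int (A t w m) - consumption t w m)"
  unfolding queue_update[OF assms] consumption_def by simp

lemma queue_change_bound:
  assumes "w \<in> space M"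
  shows "\<bar>real_of_int (A t w m) - consumption t w m\<bar> \<le> max (Amax S m) (mu_max S m)"
proof -
  have "consumption t w m
      = real_of_int (\<Sum>k\<in>UNIV. int (beta S m k) * of_bool (Z t w k) * int (D t w k))"
    by (simp add: consumption_def)
  also have "\<dots> \<le> real_of_int (int (mu_max S m))"
    unfolding of_int_le_iff by (rule consumption_le_mu_max[OF UNIV_I assms])
  finally have "consumption t w m \<le> mu_max S m" by simp
  moreover have "0 \<le> consumption t w m"
    by (auto simp: consumption_def intro!: sum_nonneg)
  moreover have "0 \<le> A t w m" "real_of_int (A t w m) \<le> Amax S m"
    using A_feasible[OF UNIV_I assms, of t] by (auto simp: purchases_def)
  ultimately show ?thesis by linarith
qed

lemma queue_moves:
  assumes "w \<in> space M" "t0 \<le> t"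
  shows "\<bar>real_of_int (Q t w m) - real_of_int (Q t0 w m)\<bar> \<le> real (t - t0) * max (Amax S m) (mu_max S m)"
  using assms(2)
proof (induction rule: dec_induct)
  case base
  show ?case by simp
next
  case (step t)
  have "real (Suc t - t0) * max (Amax S m) (mu_max S m)
      = real (t - t0) * max (Amax S m) (mu_max S m) + max (Amax S m) (mu_max S m)"
    using step.hyps by (simp add: Suc_diff_le distrib_right)
  then show ?case
    using step.IH queue_change_bound[OF assms(1), of t m]
    unfolding queue_update_real[OF assms(1)] by linarith
qed

lemma frame_cost_bound:
  assumes "w \<in> space M"
  shows "(\<Sum>t\<in>{t0..<t0 + T}. slot_cost_of t w)
    \<le> - V * lookahead_value S T t0 (\<lambda>t. X t w) (\<lambda>t. Y t w) + drift_const S * (real T * (real T - 1))"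
proof (rule lookahead_frame_bound[OF plant V_pos])
  show "slot_cost_of t w \<le> slot_cost S V \<theta> (Q t w) (X t w) (Y t w) a z p"
    if "a \<in> purchases S (X t w)" "\<And>k. p k \<in> prices S k" for t a z p
    by (rule slot_cost_minimal[OF assms that])
  show "purchases S (X t w) \<noteq> {}" for t
    using A_feasible[OF UNIV_I assms] by blast
qed (use assms queue_moves in \<open>auto intro: states_mem\<close>)

text \<open>The coefficient of the demand \<open>D\<^sub>k(t)\<close> in the estimate of the drift minus \<open>V\<close> times the profit.
  It is settled before the demand is drawn.\<close>

definition weight :: "nat \<Rightarrow> 'k \<Rightarrow> 'w \<Rightarrow> real" where
  "weight t k w = of_bool (Z t w k) * (V * (P t w k - alpha S k)
     + (\<Sum>m\<in>UNIV. real (beta S m k) * (real_of_int (Q t w m) - \<theta> m)))"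

lemma drift_minus_profit:
  assumes "w \<in> space M"
  shows "lyapunov \<theta> (Q (Suc t) w) - lyapunov \<theta> (Q t w)
      - V * profit S (X t w) (A t w) (Z t w) (P t w) (D t w)
    \<le> drift_const S + purchase_objective V \<theta> (Q t w) (X t w) (A t w)
      - (\<Sum>k\<in>UNIV. weight t k w * real (D t w k))"
proof -
  let ?d = "\<lambda>m. real_of_int (Q t w m) - \<theta> m"
  let ?\<delta> = "\<lambda>m. real_of_int (A t w m) - consumption t w m"
  have "(\<Sum>m\<in>UNIV. (?\<delta> m)\<^sup>2) \<le> (\<Sum>m\<in>UNIV. max ((Amax S m)\<^sup>2) ((real (mu_max S m))\<^sup>2))"
  proof (rule sum_mono)
    fix m
    have "(?\<delta> m)\<^sup>2 \<le> (max (Amax S m) (mu_max S m))\<^sup>2"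
      using queue_change_bound[OF assms] by (intro power2_le_iff_abs_le[THEN iffD2]) (auto simp: le_max_iff_disj)
    then show "(?\<delta> m)\<^sup>2 \<le> max ((Amax S m)\<^sup>2) ((real (mu_max S m))\<^sup>2)"
      by (simp add: max_square Amax_nonneg)
  qed
  then have "lyapunov \<theta> (Q (Suc t) w) - lyapunov \<theta> (Q t w)
      \<le> (\<Sum>m\<in>UNIV. ?d m * ?\<delta> m) + drift_const S"
    using lyapunov_diff[where q' = "Q (Suc t) w" and q = "Q t w" and \<delta> = ?\<delta> and \<theta> = \<theta>,
        OF queue_update_real[OF assms]]
    by (simp add: drift_const_def)
  also have "(\<Sum>m\<in>UNIV. ?d m * ?\<delta> m) = (\<Sum>m\<in>UNIV. real_of_int (A t w m) * ?d m)
      - (\<Sum>m\<in>UNIV. \<Sum>k\<in>UNIV. of_bool (Z t w k) * (real (beta S m k) * (?d m * real (D t w k))))"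
    by (simp add: consumption_def right_diff_distrib[of "a - b" for a b] sum_subtractf sum_distrib_left mult_ac
        del: sum_of_bool_mult_eq sum_mult_of_bool_eq)
  also have "(\<Sum>m\<in>UNIV. \<Sum>k\<in>UNIV. of_bool (Z t w k) * (real (beta S m k) * (?d m * real (D t w k))))
      = (\<Sum>k\<in>UNIV. of_bool (Z t w k) * (\<Sum>m\<in>UNIV. real (beta S m k) * ?d m) * real (D t w k))"
    by (subst sum.swap) (simp add: sum_distrib_left sum_distrib_right mult_ac
        del: sum_of_bool_mult_eq sum_mult_of_bool_eq)
  finally have "lyapunov \<theta> (Q (Suc t) w) - lyapunov \<theta> (Q t w)
      \<le> (\<Sum>m\<in>UNIV. real_of_int (A t w m) * ?d m)
        - (\<Sum>k\<in>UNIV. of_bool (Z t w k) * (\<Sum>m\<in>UNIV. real (beta S m k) * ?d m) * real (D t w k))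
        + drift_const S" .
  moreover have "(\<Sum>k\<in>UNIV. weight t k w * real (D t w k))
      = V * (\<Sum>k\<in>UNIV. of_bool (Z t w k) * real (D t w k) * (P t w k - alpha S k))
        + (\<Sum>k\<in>UNIV. of_bool (Z t w k) * (\<Sum>m\<in>UNIV. real (beta S m k) * ?d m) * real (D t w k))"
    unfolding weight_def sum_distrib_left[of V] sum.distrib[symmetric]
    by (intro sum.cong) (auto simp: distrib_right)
  ultimately show ?thesis
    unfolding profit_def purchase_objective_def by (simp add: algebra_simps)
qed

lemma slot_cost_of_eq:
  "slot_cost_of t w = purchase_objective V \<theta> (Q t w) (X t w) (A t w)
    - (\<Sum>k\<in>UNIV. weight t k w * mean_demand S k (P t w k) (Y t w))"
proof -
  have "of_bool (Z t w k) * price_objective S V \<theta> (Q t w) (Y t w) k (P t w k)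
      = weight t k w * mean_demand S k (P t w k) (Y t w)" for k
    by (simp add: weight_def price_objective_def algebra_simps)
  then show ?thesis
    unfolding slot_cost_of_def slot_cost_def by (simp only:)
qed

abbreviation "info \<equiv> information M UNIV (queue_events M Q) X Y A Z P D"

lemma queue_measurable_info: "(\<lambda>w. f (Q t w)) \<in> borel_measurable (info t)" for f :: "_ \<Rightarrow> real"
proof -
  have "generated M (Q t) (count_space UNIV) \<subseteq> sets (info t)"
    using generated_information(1)[OF UNIV_I, of t] by (auto simp: queue_events_def)
  then have "Q t \<in> info t \<rightarrow>\<^sub>M count_space UNIV"
    by (intro measurable_generated[where M = M]) auto
  then show ?thesis
    by (rule measurable_compose) simp
qed

lemma queue_measurable: "(\<lambda>w. f (Q t w)) \<in> borel_measurable M" for f :: "_ \<Rightarrow> real"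
  by (rule measurable_from_subalg[OF subalgebra_information[OF UNIV_I] queue_measurable_info])

lemma queue_offset_bound:
  assumes "w \<in> space M"
  shows "\<bar>real_of_int (Q t w m) - \<theta> m\<bar> \<le> \<bar>\<theta> m\<bar> + Amax S m"
proof -
  have "0 \<le> Q t w m" "real_of_int (Q t w m) - \<theta> m \<le> Amax S m"
    using queue_range(1)[OF assms, of m t] queue_range(2)[OF assms, of t m] by linarith+
  then show ?thesis using Amax_nonneg[of m] by linarith
qed

lemma weight_measurable: "weight t k \<in> borel_measurable (info t)"
  unfolding weight_def
  using measurable_compose[OF decisions_measurable_information(2)[OF UNIV_I, of t],
      of "\<lambda>z. of_bool (z k) :: real" borel]
  by (intro borel_measurable_times borel_measurable_add borel_measurable_diff borel_measurable_const
      decisions_measurable_information(3)[OF UNIV_I] queue_measurable_info) auto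

definition weight_bound :: "'k \<Rightarrow> real" where
  "weight_bound k = V * (Pmax S k + alpha S k) + (\<Sum>m\<in>UNIV. real (beta S m k) * (\<bar>\<theta> m\<bar> + Amax S m))"

lemma weight_le_bound:
  assumes "w \<in> space M"
  shows "\<bar>weight t k w\<bar> \<le> weight_bound k"
proof -
  have "\<bar>\<Sum>m\<in>UNIV. real (beta S m k) * (real_of_int (Q t w m) - \<theta> m)\<bar>
      \<le> (\<Sum>m\<in>UNIV. real (beta S m k) * (\<bar>\<theta> m\<bar> + Amax S m))"
    using queue_offset_bound[OF assms]
    by (intro order_trans[OF sum_abs] sum_mono) (auto simp: abs_mult intro: mult_left_mono)
  moreover have "\<bar>V * (P t w k - alpha S k)\<bar> \<le> V * (Pmax S k + alpha S k)"
    using margin_bound[OF plant P_feasible[OF UNIV_I assms]] V_pos by (simp add: abs_mult)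
  ultimately have "\<bar>V * (P t w k - alpha S k)
      + (\<Sum>m\<in>UNIV. real (beta S m k) * (real_of_int (Q t w m) - \<theta> m))\<bar> \<le> weight_bound k"
    unfolding weight_bound_def by linarith
  then show ?thesis
    by (cases "Z t w k") (auto simp: weight_def)
qed

lemma integrable_lyapunov: "integrable M (\<lambda>w. lyapunov \<theta> (Q t w))"
proof (rule integrable_bounded)
  fix w assume "w \<in> space M"
  then show "\<bar>lyapunov \<theta> (Q t w)\<bar> \<le> 1/2 * (\<Sum>m\<in>UNIV. (\<bar>\<theta> m\<bar> + Amax S m)\<^sup>2)"
    using queue_offset_bound
    by (auto simp: lyapunov_def sum_nonneg intro!: sum_mono power2_le_iff_abs_le[THEN iffD2] add_nonneg_nonneg Amax_nonneg)
qed (rule queue_measurable)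

lemma integrable_purchase_objective:
  "integrable M (\<lambda>w. purchase_objective V \<theta> (Q t w) (X t w) (A t w))"
  unfolding purchase_objective_def
proof (intro Bochner_Integration.integrable_add integrable_mult_right Bochner_Integration.integrable_sum)
  show "integrable M (\<lambda>w. purchase_cost (A t w) (X t w))"
    by (rule integrable_purchase_cost[OF plant UNIV_I])
  show "integrable M (\<lambda>w. real_of_int (A t w m) * (real_of_int (Q t w m) - \<theta> m))" for m
  proof (rule integrable_bounded)
    fix w assume w: "w \<in> space M"
    have "0 \<le> A t w m" "real_of_int (A t w m) \<le> Amax S m"
      using A_feasible[OF UNIV_I w, of t] by (auto simp: purchases_def)
    then show "\<bar>real_of_int (A t w m) * (real_of_int (Q t w m) - \<theta> m)\<bar>
        \<le> Amax S m * (\<bar>\<theta> m\<bar> + Amax S m)"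
      unfolding abs_mult using queue_offset_bound[OF w] by (intro mult_mono) auto
  qed (intro borel_measurable_times purchase_measurable UNIV_I queue_measurable)
qed

lemma integrable_indicator_times:
  assumes "G \<in> sets M" "integrable M f"
  shows "integrable M (\<lambda>w. indicator G w * f w :: real)"
  using integrable_mult_indicator[OF assms] by simp

lemma
  assumes G: "G \<in> sets (info t)"
  shows integrable_weighted_demand: "integrable M (\<lambda>w. indicator G w * (weight t k w * real (D t w k)))"
    and integrable_weighted_mean_demand:
      "integrable M (\<lambda>w. indicator G w * (weight t k w * mean_demand S k (P t w k) (Y t w)))"
    and integral_weighted_demand: "(\<integral>w. indicator G w * (weight t k w * real (D t w k)) \<partial>M)
      = (\<integral>w. indicator G w * (weight t k w * mean_demand S k (P t w k) (Y t w)) \<partial>M)"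
proof -
  define h where "h = (\<lambda>w. indicator G w * weight t k w)"
  have h: "h \<in> borel_measurable (info t)"
    unfolding h_def using G by (intro borel_measurable_times weight_measurable) simp
  have bound: "\<bar>h w\<bar> \<le> weight_bound k" if "w \<in> space M" for w
    using weight_le_bound[OF that, of t k] by (auto simp: h_def indicator_def)
  have hM: "h \<in> borel_measurable M"
    by (rule measurable_from_subalg[OF subalgebra_information[OF UNIV_I] h])
  show "integrable M (\<lambda>w. indicator G w * (weight t k w * real (D t w k)))"
    "integrable M (\<lambda>w. indicator G w * (weight t k w * mean_demand S k (P t w k) (Y t w)))"
    using integrable_times_demand[OF plant UNIV_I hM bound] unfolding h_def by (auto simp: mult_ac)
  show "(\<integral>w. indicator G w * (weight t k w * real (D t w k)) \<partial>M)
      = (\<integral>w. indicator G w * (weight t k w * mean_demand S k (P t w k) (Y t w)) \<partial>M)"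
    using integral_demand[OF plant UNIV_I h bound] unfolding h_def by (auto simp: mult_ac)
qed

lemma integrable_slot_cost: "integrable M (slot_cost_of t)"
proof -
  have "integrable M (\<lambda>w. weight t k w * mean_demand S k (P t w k) (Y t w))" for k
    using integrable_weighted_mean_demand[OF sets.top, of t k]
    by (subst (asm) Bochner_Integration.integrable_cong[OF refl,
          where g = "\<lambda>w. weight t k w * mean_demand S k (P t w k) (Y t w)"]) auto
  then show ?thesis
    unfolding slot_cost_of_eq using integrable_purchase_objective by simp
qed

text \<open>After integration the demands in \<open>drift_minus_profit\<close> may be replaced by their means, which turns
  its right-hand side into the slot cost.\<close>

lemma expected_drift:
  assumes G: "G \<in> sets (info t)"
  shows "(\<integral>w. indicator G w * (lyapunov \<theta> (Q (Suc t) w) - lyapunov \<theta> (Q t w)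
        - V * profit S (X t w) (A t w) (Z t w) (P t w) (D t w)) \<partial>M)
    \<le> (\<integral>w. indicator G w * (drift_const S + slot_cost_of t w) \<partial>M)"
proof -
  have GM: "G \<in> sets M"
    using G subalgebra_information[OF UNIV_I, of t] by (auto simp: subalgebra_def)
  define g where "g = (indicator G :: 'w \<Rightarrow> real)"
  have g_nonneg: "0 \<le> g w" for w by (simp add: g_def)
  note int = integrable_weighted_demand[OF G, folded g_def]
    integrable_weighted_mean_demand[OF G, folded g_def]
    integrable_indicator_times[OF GM integrable_purchase_objective, of t, folded g_def]
    integrable_indicator_times[OF GM integrable_const, of "drift_const S", folded g_def]
  have "(\<integral>w. g w * (lyapunov \<theta> (Q (Suc t) w) - lyapunov \<theta> (Q t w)
        - V * profit S (X t w) (A t w) (Z t w) (P t w) (D t w)) \<partial>M)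
    \<le> (\<integral>w. g w * (drift_const S + purchase_objective V \<theta> (Q t w) (X t w) (A t w)
        - (\<Sum>k\<in>UNIV. weight t k w * real (D t w k))) \<partial>M)"
  proof (rule integral_mono)
    show "integrable M (\<lambda>w. g w * (lyapunov \<theta> (Q (Suc t) w) - lyapunov \<theta> (Q t w)
        - V * profit S (X t w) (A t w) (Z t w) (P t w) (D t w)))"
      unfolding g_def
      by (intro integrable_indicator_times GM Bochner_Integration.integrable_diff integrable_lyapunov
          integrable_mult_right integrable_profit plant UNIV_I)
    show "integrable M (\<lambda>w. g w * (drift_const S + purchase_objective V \<theta> (Q t w) (X t w) (A t w)
        - (\<Sum>k\<in>UNIV. weight t k w * real (D t w k))))"
      using int by (simp add: distrib_left right_diff_distrib sum_distrib_left)
  qed (intro mult_left_mono drift_minus_profit g_nonneg, assumption)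
  also have "\<dots> = (\<integral>w. g w * (drift_const S + slot_cost_of t w) \<partial>M)"
    using int integral_weighted_demand[OF G, folded g_def] unfolding slot_cost_of_eq
    by (simp add: distrib_left right_diff_distrib sum_distrib_left)
  finally show ?thesis unfolding g_def .
qed

end

section \<open>Profit over several frames, conditionally on the history\<close>

context started_jpp
begin

lemma sets_history:
  "sets (history M X Y Q T t) = sigma_sets (space M)
     ((\<Union>s\<in>{..<t + T}. generated M (X s) (count_space UNIV) \<union> generated M (Y s) (count_space UNIV))
      \<union> queue_events M Q t)"
  unfolding history_def queue_events_def
  by (intro sets_measure_of Un_least UN_least generated_subset_Pow)

lemma space_history [simp]: "space (history M X Y Q T t) = space M"
  by (simp add: history_def space_measure_of_conv)

lemma history_subset_info: "sets (history M X Y Q T 0) \<subseteq> sets (info t)"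
proof -
  have "queue_events M Q 0 \<subseteq> sets (info t)"
    using generated_information(1)[OF UNIV_I, of t] by (auto simp: queue_events_def)
  then show ?thesis
    unfolding sets_history space_information[of t, symmetric]
    by (intro sets.sigma_sets_subset Un_least UN_least generated_information(2,3)[OF UNIV_I UNIV_I])
qed

lemma subalgebra_history: "subalgebra M (history M X Y Q T 0)"
  using history_subset_info[of T 0] subalgebra_information[OF UNIV_I, of 0]
  by (auto simp: subalgebra_def)

lemma initial_queue_measurable_history:
  "(\<lambda>w. f (Q 0 w)) \<in> borel_measurable (history M X Y Q T 0)" for f :: "_ \<Rightarrow> real"
proof -
  have "generated M (Q 0) (count_space UNIV) \<subseteq> sets (history M X Y Q T 0)"
    unfolding sets_history queue_events_def by (rule order_trans[OF _ sigma_sets_superset_generator]) auto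
  then have "Q 0 \<in> history M X Y Q T 0 \<rightarrow>\<^sub>M count_space UNIV"
    by (intro measurable_generated[where M = M]) auto
  then show ?thesis
    by (rule measurable_compose) simp
qed

text \<open>The state spaces may be countably infinite, but finitely many slots admit only countably many
  trajectories; hence anything that depends on the states before slot \<open>T\<close> alone is
  known from the history, however irregular it may be.\<close>

lemma state_function_measurable_history:
  fixes f :: "(nat \<Rightarrow> 'm supply_state) \<Rightarrow> (nat \<Rightarrow> 'y) \<Rightarrow> real"
  assumes local: "\<And>x x' y y'. (\<And>t. t < T \<Longrightarrow> x t = x' t) \<Longrightarrow> (\<And>t. t < T \<Longrightarrow> y t = y' t) \<Longrightarrow> f x y = f x' y'"
  shows "(\<lambda>w. f (\<lambda>t. X t w) (\<lambda>t. Y t w)) \<in> borel_measurable (history M X Y Q T 0)"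
proof -
  let ?H = "history M X Y Q T 0"
  define r where "r = (\<lambda>w. \<lambda>t\<in>{..<T}. (X t w, Y t w))"
  let ?R = "PiE {..<T} (\<lambda>_. supply_states S \<times> demand_states S)"
  have X_H: "X t \<in> ?H \<rightarrow>\<^sub>M count_space UNIV" and Y_H: "Y t \<in> ?H \<rightarrow>\<^sub>M count_space UNIV" if "t < T" for t
  proof -
    have "generated M (X t) (count_space UNIV) \<subseteq> sets ?H" "generated M (Y t) (count_space UNIV) \<subseteq> sets ?H"
      unfolding sets_history using that
      by (auto intro!: order_trans[OF _ sigma_sets_superset_generator])
    then show "X t \<in> ?H \<rightarrow>\<^sub>M count_space UNIV" "Y t \<in> ?H \<rightarrow>\<^sub>M count_space UNIV"
      by (auto intro!: measurable_generated[where M = M])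
  qed
  have "countable ?R"
    using plant by (intro countable_PiE) (auto simp: valid_plant_def)
  then have "r \<in> ?H \<rightarrow>\<^sub>M count_space ?R"
  proof (subst measurable_count_space_eq_countable, simp, intro conjI ballI)
    show "r \<in> space ?H \<rightarrow> ?R"
      using states_mem[OF UNIV_I] by (auto simp: r_def)
    fix a assume a: "a \<in> ?R"
    have "r -` {a} \<inter> space ?H = {w \<in> space ?H. \<forall>t\<in>{..<T}. X t w = fst (a t) \<and> Y t w = snd (a t)}"
    proof -
      have "r w = a \<longleftrightarrow> (\<forall>t\<in>{..<T}. X t w = fst (a t) \<and> Y t w = snd (a t))" for w
        using a unfolding r_def fun_eq_iff by (auto simp: restrict_def PiE_def extensional_def prod_eq_iff)
      then show ?thesis by auto
    qed
    also have "\<dots> \<in> sets ?H"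
    proof (rule sets.sets_Collect_finite_All)
      fix t assume "t \<in> {..<T}"
      then have "X t -` {fst (a t)} \<inter> space ?H \<in> sets ?H" "Y t -` {snd (a t)} \<inter> space ?H \<in> sets ?H"
        using measurable_sets[OF X_H, of t "{fst (a t)}"] measurable_sets[OF Y_H, of t "{snd (a t)}"]
        by auto
      then have "(X t -` {fst (a t)} \<inter> space ?H) \<inter> (Y t -` {snd (a t)} \<inter> space ?H) \<in> sets ?H"
        by (rule sets.Int)
      also have "(X t -` {fst (a t)} \<inter> space ?H) \<inter> (Y t -` {snd (a t)} \<inter> space ?H)
          = {w \<in> space ?H. X t w = fst (a t) \<and> Y t w = snd (a t)}" by auto
      finally show "{w \<in> space ?H. X t w = fst (a t) \<and> Y t w = snd (a t)} \<in> sets ?H" .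
    qed simp
    finally show "r -` {a} \<inter> space ?H \<in> sets ?H" .
  qed
  then have "(\<lambda>w. f (\<lambda>t. fst (r w t)) (\<lambda>t. snd (r w t))) \<in> borel_measurable ?H"
    by (rule measurable_compose) simp
  moreover have "f (\<lambda>t. fst (r w t)) (\<lambda>t. snd (r w t)) = f (\<lambda>t. X t w) (\<lambda>t. Y t w)" for w
    by (rule local) (auto simp: r_def)
  ultimately show ?thesis by simp
qed

definition lookahead_sum :: "nat \<Rightarrow> nat \<Rightarrow> 'w \<Rightarrow> real" where
  "lookahead_sum J T w = (\<Sum>j<J. lookahead_value S T (j * T) (\<lambda>\<tau>. X \<tau> w) (\<lambda>\<tau>. Y \<tau> w))"

lemma lookahead_sum_measurable:
  "lookahead_sum J T \<in> borel_measurable (history M X Y Q (J * T) 0)"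
  unfolding lookahead_sum_def
proof (rule borel_measurable_sum)
  fix j assume "j \<in> {..<J}"
  then have "Suc j * T \<le> J * T" by (intro mult_le_mono1) simp
  then have "t < J * T" if "t \<in> {j * T..<j * T + T}" for t
    using that by simp
  then show "(\<lambda>w. lookahead_value S T (j * T) (\<lambda>\<tau>. X \<tau> w) (\<lambda>\<tau>. Y \<tau> w))
      \<in> borel_measurable (history M X Y Q (J * T) 0)"
    by (intro state_function_measurable_history lookahead_value_cong) auto
qed

lemma lookahead_sum_bounded:
  assumes "w \<in> space M"
  shows "\<bar>lookahead_sum J T w\<bar> \<le> (\<Sum>j<J. real T * profit_bound S)"
  unfolding lookahead_sum_def
proof (intro order_trans[OF sum_abs] sum_mono lookahead_value_bounded plant)
  show "lookahead_policies S T (j * T) (\<lambda>\<tau>. X \<tau> w) (\<lambda>\<tau>. Y \<tau> w) \<noteq> {}" for j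
    using A_feasible[OF UNIV_I assms] states_mem[OF UNIV_I assms]
    by (intro lookahead_policies_nonempty plant) blast+
qed

lemma integrable_lookahead_sum: "integrable M (lookahead_sum J T)"
  by (rule integrable_bounded[OF measurable_from_subalg[OF subalgebra_history lookahead_sum_measurable]
        lookahead_sum_bounded])

lemma sum_frames: "(\<Sum>t<J * T. f t) = (\<Sum>j<J. \<Sum>t\<in>{j * T..<j * T + T}. f t)" for f :: "nat \<Rightarrow> real"
  using sum.nat_group[of f T J] by simp

text \<open>The \<open>T\<close> drift constants of a frame and the price \<open>B T (T - 1)\<close> of comparing against outdated
  inventories add up to \<open>B T\<^sup>2\<close>.\<close>

lemma total_cost_bound:
  assumes "w \<in> space M"
  shows "(\<Sum>t<J * T. drift_const S + slot_cost_of t w)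
    \<le> real J * (drift_const S * (real T)\<^sup>2) - V * lookahead_sum J T w"
proof -
  have "(\<Sum>t<J * T. slot_cost_of t w)
      \<le> (\<Sum>j<J. - V * lookahead_value S T (j * T) (\<lambda>t. X t w) (\<lambda>t. Y t w)
          + drift_const S * (real T * (real T - 1)))"
    unfolding sum_frames by (intro sum_mono frame_cost_bound assms)
  also have "\<dots> = - V * lookahead_sum J T w + real J * (drift_const S * (real T * (real T - 1)))"
    unfolding sum.distrib lookahead_sum_def sum_distrib_left by simp
  finally show ?thesis
    by (simp add: sum.distrib power2_eq_square algebra_simps)
qed

lemma expected_profit_ge:
  assumes G: "G \<in> sets (history M X Y Q (J * T) 0)"
  shows "(\<integral>w. indicator G w * (lookahead_sum J T w
        - (real J * (drift_const S * (real T)\<^sup>2) + lyapunov \<theta> (Q 0 w)) / V) \<partial>M)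
    \<le> (\<integral>w. indicator G w * (\<Sum>t<J * T. profit S (X t w) (A t w) (Z t w) (P t w) (D t w)) \<partial>M)"
proof -
  define \<phi> where "\<phi> = (\<lambda>t w. profit S (X t w) (A t w) (Z t w) (P t w) (D t w))"
  define L where "L = (\<lambda>t w. lyapunov \<theta> (Q t w))"
  define g where "g = (indicator G :: 'w \<Rightarrow> real)"
  have g_nonneg: "0 \<le> g w" for w by (simp add: g_def)
  let ?n = "J * T" and ?C = "real J * (drift_const S * (real T)\<^sup>2)"
  have GM: "G \<in> sets M"
    using G subalgebra_history[of "J * T"] by (auto simp: subalgebra_def)
  have G_int: "integrable M (\<lambda>w. g w * h w)" if "integrable M h" for h :: "'w \<Rightarrow> real"
    unfolding g_def by (rule integrable_indicator_times[OF GM that])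
  have \<phi>: "integrable M (\<phi> t)" for t
    unfolding \<phi>_def by (rule integrable_profit[OF plant UNIV_I])
  have L: "integrable M (L t)" for t
    unfolding L_def by (rule integrable_lyapunov)
  note base_int = \<phi> L integrable_slot_cost integrable_lookahead_sum
  have "(\<Sum>t<?n. \<integral>w. g w * (L (Suc t) w - L t w - V * \<phi> t w) \<partial>M)
      \<le> (\<Sum>t<?n. \<integral>w. g w * (drift_const S + slot_cost_of t w) \<partial>M)"
    unfolding g_def L_def \<phi>_def using G history_subset_info by (intro sum_mono expected_drift) blast
  also have "\<dots> = (\<integral>w. (\<Sum>t<?n. g w * (drift_const S + slot_cost_of t w)) \<partial>M)"
    by (intro Bochner_Integration.integral_sum[symmetric] G_int Bochner_Integration.integrable_add
        integrable_slot_cost) simp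
  also have "\<dots> = (\<integral>w. g w * (\<Sum>t<?n. drift_const S + slot_cost_of t w) \<partial>M)"
    by (simp only: sum_distrib_left)
  also have "\<dots> \<le> (\<integral>w. g w * (?C - V * lookahead_sum J T w) \<partial>M)"
    by (intro integral_mono mult_left_mono g_nonneg total_cost_bound G_int
        Bochner_Integration.integrable_sum Bochner_Integration.integrable_add
        Bochner_Integration.integrable_diff integrable_mult_right base_int integrable_const)
  also have "(\<Sum>t<?n. \<integral>w. g w * (L (Suc t) w - L t w - V * \<phi> t w) \<partial>M)
      = (\<integral>w. (\<Sum>t<?n. g w * (L (Suc t) w - L t w - V * \<phi> t w)) \<partial>M)"
    by (intro Bochner_Integration.integral_sum[symmetric] G_int Bochner_Integration.integrable_diff
        integrable_mult_right base_int)
  also have "\<dots> = (\<integral>w. g w * (L ?n w - L 0 w - V * (\<Sum>t<?n. \<phi> t w)) \<partial>M)"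
  proof (intro Bochner_Integration.integral_cong refl)
    fix w
    have "(\<Sum>t<?n. L (Suc t) w - L t w) = L ?n w - L 0 w"
      by (rule sum_lessThan_telescope)
    then show "(\<Sum>t<?n. g w * (L (Suc t) w - L t w - V * \<phi> t w))
        = g w * (L ?n w - L 0 w - V * (\<Sum>t<?n. \<phi> t w))"
      by (simp add: sum_distrib_left[symmetric] sum_subtractf)
  qed
  finally have le: "(\<integral>w. g w * (L ?n w - L 0 w - V * (\<Sum>t<?n. \<phi> t w)) \<partial>M)
      \<le> (\<integral>w. g w * (?C - V * lookahead_sum J T w) \<partial>M)" .
  (* The final value of the Lyapunov function is nonnegative and can be dropped. *)
  have "(\<integral>w. g w * (- L 0 w - V * (\<Sum>t<?n. \<phi> t w)) \<partial>M)
      \<le> (\<integral>w. g w * (L ?n w - L 0 w - V * (\<Sum>t<?n. \<phi> t w)) \<partial>M)"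
  proof (intro integral_mono mult_left_mono g_nonneg)
    show "- L 0 w - V * (\<Sum>t<?n. \<phi> t w) \<le> L ?n w - L 0 w - V * (\<Sum>t<?n. \<phi> t w)" for w
      by (simp add: L_def lyapunov_def sum_nonneg)
  qed (intro G_int Bochner_Integration.integrable_diff integrable_minus integrable_mult_right
      Bochner_Integration.integrable_sum base_int)+
  note le = order_trans[OF this le]
  have "V * ((\<integral>w. g w * (lookahead_sum J T w - (?C + L 0 w) / V) \<partial>M)
      - (\<integral>w. g w * (\<Sum>t<?n. \<phi> t w) \<partial>M))
    = (\<integral>w. V * (g w * (lookahead_sum J T w - (?C + L 0 w) / V) - g w * (\<Sum>t<?n. \<phi> t w)) \<partial>M)"
    by (subst integral_mult_right_zero, subst Bochner_Integration.integral_diff)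
       (intro G_int Bochner_Integration.integrable_diff integrable_divide
        Bochner_Integration.integrable_add Bochner_Integration.integrable_sum base_int integrable_const refl)+
  also have "\<dots> = (\<integral>w. g w * (- L 0 w - V * (\<Sum>t<?n. \<phi> t w)) - g w * (?C - V * lookahead_sum J T w) \<partial>M)"
    using V_pos by (intro Bochner_Integration.integral_cong refl) (simp add: field_simps)
  also have "\<dots> = (\<integral>w. g w * (- L 0 w - V * (\<Sum>t<?n. \<phi> t w)) \<partial>M)
      - (\<integral>w. g w * (?C - V * lookahead_sum J T w) \<partial>M)"
    by (intro Bochner_Integration.integral_diff G_int Bochner_Integration.integrable_diff integrable_minus
        integrable_mult_right Bochner_Integration.integrable_sum base_int integrable_const)
  also have "\<dots> \<le> 0" using le by simp
  finally show ?thesis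
    using V_pos unfolding g_def L_def \<phi>_def by (simp add: mult_le_0_iff)
qed

lemma conditional_profit_ge:
  "AE w in M. lookahead_sum J T w - (real J * (drift_const S * (real T)\<^sup>2) + lyapunov \<theta> (Q 0 w)) / V
    \<le> (\<Sum>t<J * T. real_cond_exp M (history M X Y Q (J * T) 0)
          (\<lambda>v. profit S (X t v) (A t v) (Z t v) (P t v) (D t v)) w)"
proof -
  let ?H = "history M X Y Q (J * T) 0"
  let ?\<phi> = "\<lambda>t v. profit S (X t v) (A t v) (Z t v) (P t v) (D t v)"
  interpret H: finite_measure_subalgebra M ?H
    by unfold_locales (rule subalgebra_history)
  have "AE w in M. lookahead_sum J T w - (real J * (drift_const S * (real T)\<^sup>2) + lyapunov \<theta> (Q 0 w)) / V
    \<le> real_cond_exp M ?H (\<lambda>v. \<Sum>t<J * T. ?\<phi> t v) w"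
  proof (rule H.real_cond_exp_ge)
    show "integrable M (\<lambda>v. \<Sum>t<J * T. ?\<phi> t v)"
      by (intro Bochner_Integration.integrable_sum integrable_profit plant UNIV_I)
    show "integrable M (\<lambda>w. lookahead_sum J T w
        - (real J * (drift_const S * (real T)\<^sup>2) + lyapunov \<theta> (Q 0 w)) / V)"
      by (intro Bochner_Integration.integrable_diff integrable_lookahead_sum integrable_divide
          Bochner_Integration.integrable_add integrable_const integrable_lyapunov)
    show "(\<lambda>w. lookahead_sum J T w
        - (real J * (drift_const S * (real T)\<^sup>2) + lyapunov \<theta> (Q 0 w)) / V) \<in> borel_measurable ?H"
      by (intro borel_measurable_diff borel_measurable_divide borel_measurable_add borel_measurable_const
          lookahead_sum_measurable initial_queue_measurable_history)
  qed (rule expected_profit_ge)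
  moreover have "AE w in M. real_cond_exp M ?H (\<lambda>v. \<Sum>t<J * T. ?\<phi> t v) w
      = (\<Sum>t<J * T. real_cond_exp M ?H (?\<phi> t) w)"
    by (rule H.real_cond_exp_sum) (rule integrable_profit[OF plant UNIV_I])
  ultimately show ?thesis
    by eventually_elim simp
qed

lemma time_average_profit_ge:
  assumes "J > 0" "T > 0"
  shows "AE w in M. 1 / (real J * real T)
        * (\<Sum>j<J. lookahead_value S T (j * T) (\<lambda>\<tau>. X \<tau> w) (\<lambda>\<tau>. Y \<tau> w))
      - drift_const S * real T / V - lyapunov \<theta> (Q 0 w) / (V * real J * real T)
    \<le> 1 / (real J * real T) * (\<Sum>\<tau><J * T. real_cond_exp M (history M X Y Q (J * T) 0)
          (\<lambda>v. profit S (X \<tau> v) (A \<tau> v) (Z \<tau> v) (P \<tau> v) (D \<tau> v)) w)"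
  using conditional_profit_ge[of J T]
proof eventually_elim
  case (elim w)
  have "1 / (real J * real T) * lookahead_sum J T w - drift_const S * real T / V
      - lyapunov \<theta> (Q 0 w) / (V * real J * real T)
    = 1 / (real J * real T) * (lookahead_sum J T w
        - (real J * (drift_const S * (real T)\<^sup>2) + lyapunov \<theta> (Q 0 w)) / V)"
    using assms V_pos by (simp add: field_simps power2_eq_square)
  also have "\<dots> \<le> 1 / (real J * real T) * (\<Sum>\<tau><J * T. real_cond_exp M (history M X Y Q (J * T) 0)
          (\<lambda>v. profit S (X \<tau> v) (A \<tau> v) (Z \<tau> v) (P \<tau> v) (D \<tau> v)) w)"
    using elim by (intro mult_left_mono) auto
  finally show ?case unfolding lookahead_sum_def .
qed

end

section \<open>Inventory range and profit of the algorithm\<close>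

theorem theorem5:
  fixes M :: "'w measure"
    and S :: "('m::finite, 'k::finite, 'y) plant"
    and X :: "nat \<Rightarrow> 'w \<Rightarrow> 'm supply_state"
    and Y :: "nat \<Rightarrow> 'w \<Rightarrow> 'y"
    and Q :: "nat \<Rightarrow> 'w \<Rightarrow> 'm \<Rightarrow> int"
    and A :: "nat \<Rightarrow> 'w \<Rightarrow> 'm \<Rightarrow> int"
    and Z :: "nat \<Rightarrow> 'w \<Rightarrow> 'k \<Rightarrow> bool"
    and P :: "nat \<Rightarrow> 'w \<Rightarrow> 'k \<Rightarrow> real"
    and D :: "nat \<Rightarrow> 'w \<Rightarrow> 'k \<Rightarrow> nat"
    and V :: real
  assumes "V > 0"
    and "jpp M S X Y Q A Z P D V (theta S V)"
    and "\<forall>w\<in>space M. \<forall>m. real (mu_max S m) \<le> real_of_int (Q 0 w m) \<and>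
           real_of_int (Q 0 w m) \<le> theta S V m + Amax S m"
  shows "(\<forall>w\<in>space M. \<forall>m t. real (mu_max S m) \<le> real_of_int (Q t w m) \<and>
            real_of_int (Q t w m) \<le> Qmax S V m) \<and>
         (\<forall>m. (\<lambda>v. Qmax S v m) \<in> O[at_top](\<lambda>v. v)) \<and>
         (\<forall>J T. J > 0 \<longrightarrow> T > 0 \<longrightarrow>
           (AE w in M.
              1 / (real J * real T) *
                (\<Sum>\<tau><J * T. real_cond_exp M (history M X Y Q (J * T) 0)
                   (\<lambda>v. profit S (X \<tau> v) (A \<tau> v) (Z \<tau> v) (P \<tau> v) (D \<tau> v)) w)
              \<ge> 1 / (real J * real T) *
                  (\<Sum>j<J. lookahead_value S T (j * T) (\<lambda>\<tau>. X \<tau> w) (\<lambda>\<tau>. Y \<tau> w))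
                - drift_const S * real T / V
                - lyapunov (theta S V) (Q 0 w) / (V * real J * real T)))"
proof -
  have "real n \<le> real_of_int i \<longleftrightarrow> int n \<le> i" for n i
    by linarith
  then have run: "started_jpp M S X Y Q A Z P D V (theta S V)"
    using assms by (auto simp: started_jpp_def started_jpp_axioms_def Qmax_def)
  have "real (mu_max S m) \<le> real_of_int (Q t w m) \<and> real_of_int (Q t w m) \<le> Qmax S V m"
    if "w \<in> space M" for w m t
    using started_jpp.queue_range[OF run that] unfolding Qmax_def by (metis of_int_le_iff of_int_of_nat_eq)
  moreover have "(\<lambda>v. Qmax S v m) \<in> O[at_top](\<lambda>v. v)" for m
    by (rule Qmax_bigo[OF jpp.plant[OF assms(2)]])
  ultimately show ?thesis
    using started_jpp.time_average_profit_ge[OF run] by blast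
qed

end
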